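(* Let $\Omega\subseteq\mathbb{R}^n$ be a closed convex set, let $\hat\alpha,\hat\beta$ be probability distributions on $\Omega$ such that $\hat\gamma=\frac12\hat\alpha+\frac12\hat\beta$ is a finite mixture of Diracs, let $k\colon\Omega^2\to\mathbb{R}$ be a symmetric positive semi-definite kernel with $k\in L^2(\Omega^2)$, and let $a,b\colon\mathbb{R}\to\mathbb{R}$ be differentiable with Lipschitz derivatives over $\mathbb{R}$. Let $\mathcal{L}_{\hat\alpha}(f)=\mathbb{E}_{x\sim\hat\alpha}[a(f(x))]-\mathbb{E}_{y\sim\hat\beta}[b(f(y))]$. Then, for every $f_0\in L^2(\Omega)$, the equation $$\partial_t f_t=\mathcal{T}_{k,\hat\gamma}\big(\nabla^{\hat\gamma}\mathcal{L}_{\hat\alpha}(f_t)\big)$$ with initial value $f_0$ admits a unique solution $f_\cdot\colon\mathbb{R}_+\to L^2(\Omega)$. Moreover, for all $t\in\mathbb{R}_+$, $$f_t=f_0+\int_0^t\mathcal{T}_{k,\hat\gamma}\big(\nabla^{\hat\gamma}\mathcal{L}_{\hat\alpha}(f_s)\big)\,ds=f_0+\mathcal{T}_{k,\hat\gamma}\Big(\int_0^t\nabla^{\hat\gamma}\mathcal{L}_{\hat\alpha}(f_s)\,ds\Big).$$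
   Context: $L^2(\Omega)$ is taken with respect to Lebesgue measure on $\Omega$; its elements, and $k$, are treated as genuine everywhere-defined (measurable) functions, so that they can be evaluated at points of $\operatorname{supp}\hat\gamma$. For a finite mixture of Diracs $\mu$, $L^2(\mu)$ is the space of functions $\operatorname{supp}\mu\to\mathbb{R}$ with scalar product $\langle h,h'\rangle_{L^2(\mu)}=\int hh'\,d\mu$. Functional gradient: for $\mathcal{L}\colon L^2(\mu)\to\mathbb{R}$ regular enough, $\nabla^{\mu}\mathcal{L}(f)\in L^2(\mu)$ is the element such that $\lim_{\varepsilon\to0}\frac1\varepsilon(\mathcal{L}(f+\varepsilon\psi)-\mathcal{L}(f))=\langle\nabla^{\mu}\mathcal{L}(f),\psi\rangle_{L^2(\mu)}$ for all $\psi\in L^2(\mu)$. Since $\mathcal{L}_{\hat\alpha}(f)$ depends only on $f|_{\operatorname{supp}\hat\gamma}$, for $f\in L^2(\Omega)$ one sets $\nabla^{\hat\gamma}\mathcal{L}_{\hat\alpha}(f)=\nabla^{\hat\gamma}\mathcal{L}_{\hat\alpha}(f|_{\operatorname{supp}\hat\gamma})$. Kernel integral operator: $\mathcal{T}_{k,\mu}(h)=\int_x k(\cdot,x)h(x)\,d\mu(x)$ for $h\in L^2(\mu)$, a function defined on all of $\Omega$. The differential equation is understood pointwise on $\Omega$ (derivative of $t\mapsto f_t(x)$ for each $x\in\Omega$). *)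

theory Defs
  imports "HOL-Probability.Probability"
begin

text \<open>
  Functions with domain \<open>A\<close> are represented by extensional functions on \<open>A\<close>, so that equality of
  functions is pointwise equality on \<open>A\<close>. In particular, elements of \<open>L2_fun A\<close> are genuine
  functions and not classes modulo null sets.
\<close>

definition L2_fun :: "'a::euclidean_space set \<Rightarrow> ('a \<Rightarrow> real) set" where
  "L2_fun A = {f \<in> extensional A.
     f \<in> borel_measurable (lebesgue_on A) \<and> integrable (lebesgue_on A) (\<lambda>x. (f x)\<^sup>2)}"

definition prob_dist_on :: "'a::euclidean_space set \<Rightarrow> 'a measure \<Rightarrow> bool" where
  "prob_dist_on A M \<longleftrightarrow> prob_space M \<and> space M = A \<and> sets M = sets (restrict_space borel A)"

definition half_mixture :: "'a measure \<Rightarrow> 'a measure \<Rightarrow> 'a measure" where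
  "half_mixture M N = measure_of (space M) (sets M)
     (\<lambda>A. ennreal (1/2) * emeasure M A + ennreal (1/2) * emeasure N A)"

text \<open>The Dirac measure at \<open>x\<close> on the measurable space of \<open>M\<close> is \<open>return M x\<close>.\<close>

definition finite_dirac_mixture :: "'a measure \<Rightarrow> bool" where
  "finite_dirac_mixture M \<longleftrightarrow>
     (\<exists>S w. finite S \<and> S \<subseteq> space M \<and> (\<forall>x\<in>S. 0 \<le> w x) \<and> (\<Sum>x\<in>S. w x) = (1::real) \<and>
        (\<forall>A\<in>sets M. emeasure M A = (\<Sum>x\<in>S. ennreal (w x) * emeasure (return M x) A)))"

definition msupp :: "'a::topological_space measure \<Rightarrow> 'a set" where
  "msupp M = {x \<in> space M. \<forall>U. open U \<and> x \<in> U \<longrightarrow> emeasure M (U \<inter> space M) > 0}"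

definition psd_kernel_on :: "'a set \<Rightarrow> ('a \<times> 'a \<Rightarrow> real) \<Rightarrow> bool" where
  "psd_kernel_on A k \<longleftrightarrow>
     (\<forall>(N::nat) (x::nat \<Rightarrow> 'a) (c::nat \<Rightarrow> real). (\<forall>i<N. x i \<in> A) \<longrightarrow>
        0 \<le> (\<Sum>i<N. \<Sum>j<N. c i * c j * k (x i, x j)))"

definition sym_kernel_on :: "'a set \<Rightarrow> ('a \<times> 'a \<Rightarrow> real) \<Rightarrow> bool" where
  "sym_kernel_on A k \<longleftrightarrow> (\<forall>x\<in>A. \<forall>y\<in>A. k (x, y) = k (y, x))"

text \<open>
  For a finite mixture of Diracs \<open>M\<close>, the space \<open>L\<^sup>2(M)\<close> consists of all functions on the support.
  Integrals against such an \<open>M\<close> are taken over its (finite, full-measure) support. This does not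
  change their value, and it gives them the intended meaning also for integrands that, like the
  elements of \<open>L2_fun A\<close>, are Lebesgue but not necessarily Borel measurable.
\<close>

definition L2_supp :: "'a::topological_space measure \<Rightarrow> ('a \<Rightarrow> real) set" where
  "L2_supp M = extensional (msupp M)"

definition L2_inner :: "'a::topological_space measure \<Rightarrow> ('a \<Rightarrow> real) \<Rightarrow> ('a \<Rightarrow> real) \<Rightarrow> real" where
  "L2_inner M g h = (LINT x:msupp M|M. g x * h x)"

definition is_functional_gradient ::
  "'a::topological_space measure \<Rightarrow> (('a \<Rightarrow> real) \<Rightarrow> real) \<Rightarrow> ('a \<Rightarrow> real) \<Rightarrow> ('a \<Rightarrow> real) \<Rightarrow> bool" where
  "is_functional_gradient M L f g \<longleftrightarrow> g \<in> L2_supp M \<and>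
     (\<forall>\<psi>\<in>L2_supp M.
        ((\<lambda>\<epsilon>. 1 / \<epsilon> * (L (\<lambda>x\<in>msupp M. f x + \<epsilon> * \<psi> x) - L f)) \<longlongrightarrow> L2_inner M g \<psi>) (at 0))"

text \<open>The gradient at a function defined on a larger set is the gradient at its restriction.\<close>

definition functional_gradient ::
  "'a::topological_space measure \<Rightarrow> (('a \<Rightarrow> real) \<Rightarrow> real) \<Rightarrow> ('a \<Rightarrow> real) \<Rightarrow> ('a \<Rightarrow> real)" where
  "functional_gradient M L f = (THE g. is_functional_gradient M L (restrict f (msupp M)) g)"

definition kernel_op ::
  "('a \<times> 'a \<Rightarrow> real) \<Rightarrow> 'a::topological_space measure \<Rightarrow> ('a \<Rightarrow> real) \<Rightarrow> ('a \<Rightarrow> real)" where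
  "kernel_op k M h = (\<lambda>y. LINT x:msupp M|M. k (y, x) * h x)"

definition disc_loss ::
  "(real \<Rightarrow> real) \<Rightarrow> (real \<Rightarrow> real) \<Rightarrow> 'a::topological_space measure \<Rightarrow> 'a measure \<Rightarrow> ('a \<Rightarrow> real) \<Rightarrow> real"
  where
  "disc_loss a b M N f = (LINT x:msupp M|M. a (f x)) - (LINT y:msupp N|N. b (f y))"

definition gradient_flow_solution ::
  "'a::euclidean_space set \<Rightarrow> ('a \<times> 'a \<Rightarrow> real) \<Rightarrow> 'a measure \<Rightarrow> (('a \<Rightarrow> real) \<Rightarrow> real) \<Rightarrow>
   ('a \<Rightarrow> real) \<Rightarrow> (real \<Rightarrow> 'a \<Rightarrow> real) \<Rightarrow> bool" where
  "gradient_flow_solution A k M L f0 f \<longleftrightarrow>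
     f \<in> {0..} \<rightarrow>\<^sub>E L2_fun A \<and> f 0 = f0 \<and>
     (\<forall>t\<ge>0. \<forall>x\<in>A. ((\<lambda>s. f s x) has_real_derivative
        kernel_op k M (functional_gradient M L (f t)) x) (at t within {0..}))"

end

theory Submission
  imports Defs
begin

text \<open>
  On the finite support of \<open>\<gamma>\<close> the functional gradient is an explicit Lipschitz function of the values
  of \<open>f\<close>, so the flow restricted to the support is a finite Lipschitz system of ODEs, solved by Picard
  iteration. Away from the support, the flow is \<open>f0\<close> plus a time-dependent linear combination of the
  sections \<open>k (_, z)\<close> with \<open>z\<close> in the support.

  The subtle point is that each of these sections is a genuine element of \<open>L\<^sup>2\<close>: the support is a null
  set, so Fubini's theorem says nothing about them. Positive semi-definiteness is what helps. The
  section at \<open>x\<close> minimises a quadratic functional over finite combinations of sections, and a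
  minimising sequence taken from the (almost all) measurable sections converges to it pointwise
  almost everywhere; this gives measurability. Minimising a second functional yields
  \<open>(\<integral>\<^sub>B h\<^sup>2)\<^sup>2 \<le> k (x, x) \<cdot> \<integral>\<integral>\<^sub>B\<^sub>\<times>\<^sub>B h k h\<close> for \<open>h = k (x, _)\<close> on suitable sets \<open>B\<close>, which bounds the \<open>L\<^sup>2\<close> norm
  of \<open>h\<close> by that of \<open>k\<close>.
\<close>

section \<open>Finite combinations of kernel sections\<close>

text \<open>A list encodes a formal combination of points. Points may repeat, so adding a multiple
  of one section is a plain \<open>Cons\<close>, with no case distinction on whether the point
  already occurs.\<close>

definition lincomb :: "(real \<times> 'a) list \<Rightarrow> ('a \<Rightarrow> real) \<Rightarrow> real" where
  "lincomb l f = (\<Sum>(c, x)\<leftarrow>l. c * f x)"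

definition section_comb :: "('a \<times> 'a \<Rightarrow> real) \<Rightarrow> (real \<times> 'a) list \<Rightarrow> 'a \<Rightarrow> real" where
  "section_comb k l y = lincomb l (\<lambda>x. k (x, y))"

text \<open>For a symmetric positive semi-definite \<open>k\<close> this is the squared norm of
  \<open>section_comb k l\<close> in the reproducing kernel Hilbert space, where
  \<open>section_comb k l y\<close> is the inner product with the section at
  \<open>y\<close>.\<close>

definition kernel_energy :: "('a \<times> 'a \<Rightarrow> real) \<Rightarrow> (real \<times> 'a) list \<Rightarrow> real" where
  "kernel_energy k l = lincomb l (section_comb k l)"

lemma lincomb_Nil [simp]: "lincomb [] f = 0"
  by (simp add: lincomb_def)

lemma lincomb_Cons [simp]: "lincomb ((c, x) # l) f = c * f x + lincomb l f"
  by (simp add: lincomb_def)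

lemma section_comb_Nil [simp]: "section_comb k [] y = 0"
  by (simp add: section_comb_def)

lemma section_comb_Cons [simp]: "section_comb k ((c, x) # l) = (\<lambda>y. c * k (x, y) + section_comb k l y)"
  by (simp add: section_comb_def fun_eq_iff)

lemma lincomb_add: "lincomb l (\<lambda>x. f x + g x) = lincomb l f + lincomb l g"
  by (induction l) (auto simp: algebra_simps)

lemma lincomb_mult: "lincomb l (\<lambda>x. s * f x) = s * lincomb l f"
  by (induction l) (auto simp: algebra_simps)

lemma lincomb_scale: "lincomb (map (\<lambda>(c, x). (s * c, x)) l) f = s * lincomb l f"
  by (induction l) (auto simp: algebra_simps)

lemma kernel_energy_scale: "kernel_energy k (map (\<lambda>(c, x). (s * c, x)) l) = s\<^sup>2 * kernel_energy k l"
  by (simp add: kernel_energy_def lincomb_scale section_comb_def[abs_def] lincomb_mult power2_eq_square)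

lemma kernel_energy_Cons:
  assumes "sym_kernel_on UNIV k"
  shows "kernel_energy k ((s, y) # l) = s\<^sup>2 * k (y, y) + 2 * s * section_comb k l y + kernel_energy k l"
proof -
  have "lincomb l (\<lambda>x. k (y, x)) = section_comb k l y"
    using assms by (auto simp: section_comb_def sym_kernel_on_def intro!: arg_cong[of _ _ "lincomb l"])
  then show ?thesis
    by (simp add: kernel_energy_def lincomb_add lincomb_mult power2_eq_square algebra_simps)
qed

lemma kernel_energy_nonneg:
  assumes "psd_kernel_on UNIV k"
  shows "0 \<le> kernel_energy k l"
proof -
  have "kernel_energy k l = (\<Sum>j<length l. \<Sum>i<length l. fst (l ! j) * fst (l ! i) * k (snd (l ! j), snd (l ! i)))"
    unfolding kernel_energy_def section_comb_def lincomb_def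
    by (subst sum.swap)
       (simp add: sum_list_sum_nth case_prod_beta atLeast0LessThan sum_distrib_left mult_ac)
  also have "\<dots> \<ge> 0"
    using assms[unfolded psd_kernel_on_def, rule_format, of "length l" "\<lambda>i. snd (l ! i)" "\<lambda>i. fst (l ! i)"]
    by simp
  finally show ?thesis .
qed

section \<open>Nonnegative quadratics and the Cauchy-Schwarz inequality\<close>

lemma quadratic_nonneg_discriminant:
  fixes a b c :: real
  assumes "\<And>s. 0 \<le> s\<^sup>2 * a + 2 * s * b + c"
  shows "b\<^sup>2 \<le> a * c"
proof (cases "a = 0")
  case True
  have "b = 0"
  proof (rule ccontr)
    assume "b \<noteq> 0"
    then show False
      using assms[of "- (c + 1) / (2 * b)"] True by (simp add: field_simps)
  qed
  then show ?thesis using True by simp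
next
  case False
  have "a > 0"
  proof (rule ccontr)
    assume "\<not> a > 0"
    then have a: "a < 0" using False by simp
    have "0 \<le> c" using assms[of 0] by simp
    \<comment> \<open>This \<open>s\<close> lets the negative leading term win: it is at most
      \<open>- s * (2 * \<bar>b\<bar> + c + 1)\<close>, and with \<open>s \<ge> 1\<close> the whole
      expression is at most -1.\<close>
    define s where "s = (2 * \<bar>b\<bar> + c + 1) / (- a) + 1"
    have s1: "s \<ge> 1" unfolding s_def using a \<open>0 \<le> c\<close> by (simp add: field_simps)
    have "s * (- a) \<ge> 2 * \<bar>b\<bar> + c + 1" unfolding s_def using a by (simp add: field_simps)
    then have "s * (s * (- a)) \<ge> s * (2 * \<bar>b\<bar> + c + 1)"
      using s1 by (intro mult_left_mono) auto
    moreover have "s * (c + 1) \<ge> 1 * (c + 1)" using s1 \<open>0 \<le> c\<close> by (intro mult_right_mono) auto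
    moreover have "s * b \<le> s * \<bar>b\<bar>" using s1 by (intro mult_left_mono) auto
    ultimately show False
      using assms[of s] by (simp add: algebra_simps power2_eq_square)
  qed
  then show ?thesis
    using assms[of "- b / a"] by (simp add: field_simps power2_eq_square)
qed

text \<open>Cauchy-Schwarz between the combination \<open>l\<close> and the section at
  \<open>y\<close>: the energy of \<open>(s, y) # l\<close> is a nonnegative quadratic in
  \<open>s\<close>, and its discriminant gives the bound.\<close>

lemma section_comb_squared_le:
  assumes "sym_kernel_on UNIV k" "psd_kernel_on UNIV k"
  shows "(section_comb k l y)\<^sup>2 \<le> k (y, y) * kernel_energy k l"
  using kernel_energy_nonneg[OF assms(2), of "(_, y) # l"]
  by (intro quadratic_nonneg_discriminant) (simp add: kernel_energy_Cons[OF assms(1)])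

lemma kernel_diagonal_nonneg:
  assumes "psd_kernel_on UNIV k"
  shows "0 \<le> k (y, y)"
  using kernel_energy_nonneg[OF assms, of "[(1, y)]"] by (simp add: kernel_energy_def)

lemma square_tendsto_zeroD:
  fixes f :: "'a \<Rightarrow> real"
  assumes "((\<lambda>x. (f x)\<^sup>2) \<longlongrightarrow> 0) F"
  shows "(f \<longlongrightarrow> 0) F"
  using tendsto_real_sqrt[OF assms] by (simp add: tendsto_rabs_zero_iff)

definition section_functional ::
  "('a \<times> 'a \<Rightarrow> real) \<Rightarrow> ('a \<Rightarrow> real) \<Rightarrow> (real \<times> 'a) list \<Rightarrow> real" where
  "section_functional k \<phi> l = kernel_energy k l - 2 * lincomb l \<phi>"

text \<open>
  In the reproducing kernel Hilbert space, \<open>section_functional k \<phi>\<close> is \<open>v \<mapsto> \<parallel>v\<parallel>\<^sup>2 - 2 \<Phi> v\<close> for the linear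
  functional \<open>\<Phi>\<close> with \<open>\<Phi> (k (x, _)) = \<phi> x\<close>; minimising sequences converge to its Riesz representer.
  Perturbing a near-minimiser by a single section gives the pointwise convergence, rescaling it
  gives the convergence of \<open>\<Phi>\<close>.
\<close>

lemma section_functional_minimizing_sequence:
  fixes k :: "'a \<times> 'a \<Rightarrow> real"
  assumes sym: "sym_kernel_on UNIV k" and psd: "psd_kernel_on UNIV k"
    and bdd: "\<And>l. snd ` set l \<subseteq> G \<Longrightarrow> C \<le> section_functional k \<phi> l"
  obtains m l where "\<And>l. snd ` set l \<subseteq> G \<Longrightarrow> m \<le> section_functional k \<phi> l"
    and "\<And>n. snd ` set (l n) \<subseteq> G"
    and "\<And>y. y \<in> G \<Longrightarrow> (\<lambda>n. section_comb k (l n) y) \<longlonglongrightarrow> \<phi> y"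
    and "bounded (range (\<lambda>n. kernel_energy k (l n)))"
    and "(\<lambda>n. lincomb (l n) \<phi>) \<longlonglongrightarrow> - m"
proof -
  let ?J = "section_functional k \<phi>"
  let ?e = "kernel_energy k"
  define X where "X = ?J ` {l. snd ` set l \<subseteq> G}"
  define m where "m = Inf X"
  have X: "X \<noteq> {}" "bdd_below X"
    using bdd by (auto simp: X_def intro!: bdd_belowI exI[of _ "[]"])
  have m: "m \<le> ?J l" if "snd ` set l \<subseteq> G" for l
    unfolding m_def using that X by (intro cInf_lower) (auto simp: X_def)
  have "\<exists>l. snd ` set l \<subseteq> G \<and> ?J l < m + inverse (real (Suc n))" for n
    using cInf_lessD[OF X(1), of "m + inverse (real (Suc n))"] by (auto simp: m_def X_def)
  then obtain l where l: "\<And>n. snd ` set (l n) \<subseteq> G" "\<And>n. ?J (l n) < m + inverse (real (Suc n))"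
    by metis
  have inv0: "(\<lambda>n. C * inverse (real (Suc n))) \<longlonglongrightarrow> 0" for C
    using tendsto_mult_right_zero[OF LIMSEQ_inverse_real_of_nat, of C] by simp
  have J: "(\<lambda>n. ?J (l n)) \<longlonglongrightarrow> m"
  proof (rule real_tendsto_sandwich[OF _ _ tendsto_const LIMSEQ_inverse_real_of_nat_add])
    show "\<forall>\<^sub>F n in sequentially. m \<le> ?J (l n)"
      using l(1) m by (intro always_eventually) auto
    show "\<forall>\<^sub>F n in sequentially. ?J (l n) \<le> m + inverse (real (Suc n))"
      using l(2) by (intro always_eventually allI less_imp_le)
  qed
  have conv: "(\<lambda>n. section_comb k (l n) y) \<longlonglongrightarrow> \<phi> y" if y: "y \<in> G" for y
  proof -
    \<comment> \<open>Since \<open>l n\<close> is within \<open>inverse (real (Suc n))\<close> of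
      the infimum \<open>m\<close>, the quadratic in \<open>s\<close> produced by the perturbation
      is nonnegative once this gap is its constant term. The discriminant then bounds the error at
      \<open>y\<close>.\<close>
    have *: "(section_comb k (l n) y - \<phi> y)\<^sup>2 \<le> k (y, y) * inverse (real (Suc n))" for n
    proof (rule quadratic_nonneg_discriminant)
      fix s :: real
      have "m \<le> ?J ((s, y) # l n)" by (intro m) (use l(1) y in auto)
      also have "\<dots> = ?J (l n) + s\<^sup>2 * k (y, y) + 2 * s * (section_comb k (l n) y - \<phi> y)"
        by (simp add: section_functional_def kernel_energy_Cons[OF sym] algebra_simps)
      finally show "0 \<le> s\<^sup>2 * k (y, y) + 2 * s * (section_comb k (l n) y - \<phi> y) + inverse (real (Suc n))"
        using l(2)[of n] by simp
    qed
    have "(\<lambda>n. (section_comb k (l n) y - \<phi> y)\<^sup>2) \<longlonglongrightarrow> 0"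
      by (rule real_tendsto_sandwich[OF _ _ tendsto_const inv0[of "k (y, y)"]]) (use * in auto)
    then have "(\<lambda>n. section_comb k (l n) y - \<phi> y) \<longlonglongrightarrow> 0"
      by (rule square_tendsto_zeroD)
    then show ?thesis by (simp add: LIM_zero_iff)
  qed
  have scal: "(?e (l n) - lincomb (l n) \<phi>)\<^sup>2 \<le> ?e (l n) * inverse (real (Suc n))" for n
  proof (rule quadratic_nonneg_discriminant)
    fix s :: real
    have "m \<le> ?J (map (\<lambda>(c, x). ((1 + s) * c, x)) (l n))"
      using l(1)[of n] by (intro m) force
    also have "\<dots> = ?J (l n) + s\<^sup>2 * ?e (l n) + 2 * s * (?e (l n) - lincomb (l n) \<phi>)"
      unfolding section_functional_def kernel_energy_scale lincomb_scale
      by (simp add: power2_eq_square algebra_simps)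
    finally show "0 \<le> s\<^sup>2 * ?e (l n) + 2 * s * (?e (l n) - lincomb (l n) \<phi>) + inverse (real (Suc n))"
      using l(2)[of n] by simp
  qed
  \<comment> \<open>Since \<open>lincomb (l n) \<phi>\<close> is \<open>(E - J) / 2\<close>, the
    estimate \<open>scal\<close> becomes a bound of \<open>(E + J)\<^sup>2\<close> by
    \<open>4 * E\<close>. Dividing by \<open>E\<close> leaves \<open>E \<le> 4 - 2 * J\<close>; when
    \<open>E = 0\<close>, the claim follows from \<open>m \<le> 0\<close>, which the empty list
    provides.\<close>
  have e_le: "?e (l n) \<le> 4 - 2 * m" for n
  proof -
    define E where "E = ?e (l n)"
    define J where "J = ?J (l n)"
    have E0: "0 \<le> E" using kernel_energy_nonneg[OF psd] by (simp add: E_def)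
    have EJ: "E - lincomb (l n) \<phi> = (E + J) / 2" by (simp add: E_def J_def section_functional_def)
    have "((E + J) / 2)\<^sup>2 \<le> E * inverse (real (Suc n))"
      using scal[of n] unfolding E_def[symmetric] EJ .
    also have "\<dots> \<le> E * 1" using E0 by (intro mult_left_mono) (auto simp: field_simps)
    finally have "E\<^sup>2 + 2 * E * J + J\<^sup>2 \<le> 4 * E"
      by (simp add: power2_eq_square field_simps)
    then have "E\<^sup>2 + 2 * E * J \<le> 4 * E" using zero_le_power2[of J] by linarith
    then have "E * (E - (4 - 2 * J)) \<le> 0" by (simp add: power2_eq_square algebra_simps)
    then have "E = 0 \<or> E \<le> 4 - 2 * J" using E0 by (auto simp: mult_le_0_iff)
    moreover have "?J [] = 0" by (simp add: section_functional_def kernel_energy_def)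
    then have "m \<le> 0" using m[of "[]"] by simp
    moreover have "m \<le> J" unfolding J_def by (intro m l)
    ultimately show ?thesis unfolding E_def by auto
  qed
  have "(\<lambda>n. (?e (l n) - lincomb (l n) \<phi>)\<^sup>2) \<longlonglongrightarrow> 0"
  proof (rule real_tendsto_sandwich[OF _ _ tendsto_const inv0[of "4 - 2 * m"]])
    show "\<forall>\<^sub>F n in sequentially. (?e (l n) - lincomb (l n) \<phi>)\<^sup>2 \<le> (4 - 2 * m) * inverse (real (Suc n))"
      using scal e_le by (intro always_eventually allI) (meson mult_right_mono order_trans inverse_nonnegative_iff_nonnegative of_nat_0_le_iff)
  qed auto
  then have "(\<lambda>n. ?e (l n) - lincomb (l n) \<phi>) \<longlonglongrightarrow> 0"
    by (rule square_tendsto_zeroD)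
  \<comment> \<open>As the functional is energy minus twice \<open>lincomb\<close>, this difference
    is exactly \<open>lincomb (l n) \<phi>\<close>.\<close>
  then have "(\<lambda>n. (?e (l n) - lincomb (l n) \<phi>) - ?J (l n)) \<longlonglongrightarrow> 0 - m"
    using J by (rule tendsto_diff)
  then have "(\<lambda>n. lincomb (l n) \<phi>) \<longlonglongrightarrow> - m"
    by (simp add: section_functional_def)
  moreover have "bounded (range (\<lambda>n. kernel_energy k (l n)))"
    using e_le kernel_energy_nonneg[OF psd] by (intro boundedI[of _ "4 - 2 * m"]) auto
  ultimately show thesis using that m l(1) conv by blast
qed

section \<open>Sections of square-integrable positive semi-definite kernels\<close>

text \<open>The limit of the minimising sequence is the orthogonal projection of the section at
  \<open>x\<close> onto the closed span of the measurable sections. It has the same inner product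
  with each of these, hence the same value at almost every point.\<close>

lemma kernel_section_measurable:
  fixes k :: "'a::euclidean_space \<times> 'a \<Rightarrow> real"
  assumes sym: "sym_kernel_on UNIV k" and psd: "psd_kernel_on UNIV k"
    and ae: "AE x in lebesgue. (\<lambda>y. k (x, y)) \<in> borel_measurable lebesgue"
  shows "(\<lambda>y. k (x, y)) \<in> borel_measurable lebesgue"
proof -
  define G where "G = {x. (\<lambda>y. k (x, y)) \<in> borel_measurable lebesgue}"
  have sect: "section_comb k l \<in> borel_measurable lebesgue" if "snd ` set l \<subseteq> G" for l
    using that
  proof (induction l)
    case (Cons p l)
    then show ?case by (cases p) (auto simp: G_def)
  qed (simp add: section_comb_def[abs_def])
  \<comment> \<open>Completing the square: the functional plus \<open>k (x, x)\<close> is the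
    squared distance from the combination to the section at \<open>x\<close>.\<close>
  have "- k (x, x) \<le> section_functional k (\<lambda>y. k (y, x)) l" for l
    using kernel_energy_nonneg[OF psd, of "(-1, x) # l"]
    by (simp add: kernel_energy_Cons[OF sym] section_functional_def section_comb_def)
  then obtain l where l: "\<And>n. snd ` set (l n) \<subseteq> G"
    "\<And>y. y \<in> G \<Longrightarrow> (\<lambda>n. section_comb k (l n) y) \<longlonglongrightarrow> k (y, x)"
    using section_functional_minimizing_sequence[OF sym psd, of G "- k (x, x)" "\<lambda>y. k (y, x)"] by metis
  \<comment> \<open>\<open>lim\<close> has some value even where the sequence diverges, so
    \<open>h\<close> is a total measurable function; agreement is needed only on \<open>G\<close>,
    which has full measure.\<close>
  define h where "h y = lim (\<lambda>n. section_comb k (l n) y)" for y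
  have "h \<in> borel_measurable lebesgue"
    unfolding h_def[abs_def] using sect[OF l(1)] by measurable
  moreover have "AE y in lebesgue. h y = k (x, y)"
    using ae
  proof eventually_elim
    case (elim y)
    then have "h y = k (y, x)" using l(2)[of y] by (auto simp: G_def h_def intro: limI)
    then show ?case using sym by (simp add: sym_kernel_on_def)
  qed
  ultimately show ?thesis by (rule borel_measurable_AE)
qed

text \<open>A measurable property that holds on \<open>D\<close> holds almost everywhere on
  \<open>S\<close>: otherwise the part of \<open>S\<close> where it holds would be a measurable
  superset of \<open>D\<close> of smaller measure. Finiteness of the measure of \<open>S\<close>
  permits the subtraction.\<close>

lemma measurable_hull:
  assumes "D \<subseteq> space M"
  obtains S where "S \<in> sets M" "D \<subseteq> S" "emeasure M S = outer_measure_of M D"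
    "\<And>P. Measurable.pred M P \<Longrightarrow> (\<And>x. x \<in> D \<Longrightarrow> P x) \<Longrightarrow> emeasure M S < \<infinity> \<Longrightarrow> AE x in M. x \<in> S \<longrightarrow> P x"
proof -
  obtain S where S: "S \<in> sets M" "D \<subseteq> S" "outer_measure_of M D = emeasure M S"
    using outer_measure_of_attain[OF assms] by auto
  have "AE x in M. x \<in> S \<longrightarrow> P x"
    if P[measurable]: "Measurable.pred M P" and D: "\<And>x. x \<in> D \<Longrightarrow> P x" and fin: "emeasure M S < \<infinity>" for P
  proof -
    define T where "T = {x \<in> space M. x \<in> S \<and> P x}"
    note S(1)[measurable]
    have T[measurable]: "T \<in> sets M" unfolding T_def by measurable
    have "outer_measure_of M D \<le> emeasure M T"
      using outer_measure_of_mono[of D T M] S D assms by (auto simp: T_def subset_iff)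
    moreover have "T \<subseteq> S" by (auto simp: T_def)
    ultimately have eq: "emeasure M T = emeasure M S"
      using S by (metis antisym emeasure_mono)
    have "emeasure M (S - T) = 0"
      using emeasure_Diff[of M T S] \<open>T \<subseteq> S\<close> S(1) T fin eq by auto
    then have "S - T \<in> null_sets M" using S(1) T by auto
    then have "AE x in M. x \<notin> S - T" by (rule AE_not_in)
    then show ?thesis
      using AE_space by eventually_elim (auto simp: T_def)
  qed
  then show thesis using S that by metis
qed

text \<open>With \<open>h\<close> the section at \<open>x0\<close> and
  \<open>c = k (x0, x0)\<close>, consider the functional that integrates against \<open>h\<close>
  over a set \<open>B\<close>. Its value at \<open>h\<close> is \<open>I\<close>, the integral of
  \<open>h\<^sup>2\<close> over \<open>B\<close>, so \<open>I\<^sup>2\<close> is at most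
  \<open>c\<close> times its squared norm. That squared norm is the double integral of
  \<open>h k h\<close> over \<open>B \<times> B\<close>, hence at most \<open>I * sqrt J\<close>.
  The resulting bound \<open>c * sqrt J\<close> on \<open>I\<close> does not depend on
  \<open>B\<close>, so \<open>B\<close> can exhaust the space.\<close>

lemma kernel_section_square_integrable:
  fixes k :: "'a::euclidean_space \<times> 'a \<Rightarrow> real"
  assumes sym: "sym_kernel_on UNIV k" and psd: "psd_kernel_on UNIV k"
    and meas: "k \<in> borel_measurable lebesgue" and sq_int: "integrable lebesgue (\<lambda>z. (k z)\<^sup>2)"
  shows "(\<lambda>y. k (x0, y)) \<in> borel_measurable lebesgue"
    and "integrable lebesgue (\<lambda>y. (k (x0, y))\<^sup>2)"
proof -
  \<comment> \<open>Lebesgue measure on the product is the completion of a product measure, so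
    Fubini's theorem is applied to a Borel version of \<open>k\<close>.\<close>
  obtain k' where k'[measurable]: "k' \<in> borel_measurable lborel" and ae0: "AE z in lborel. k z = k' z"
    using completion_ex_borel_measurable_real[OF meas] by blast
  have k'2[measurable]: "k' \<in> borel_measurable (lborel \<Otimes>\<^sub>M lborel)"
    using k' by (simp add: lborel_prod)
  have ae: "AE x in lborel. AE y in lborel. k (x, y) = k' (x, y)"
    by (rule lborel_pair.AE_pair, unfold lborel_prod, rule ae0)
  have sect: "(\<lambda>y. k (x, y)) \<in> borel_measurable lebesgue" for x
  proof (rule kernel_section_measurable[OF sym psd])
    show "AE x in lebesgue. (\<lambda>y. k (x, y)) \<in> borel_measurable lebesgue"
      unfolding AE_completion_iff using ae
    proof eventually_elim
      case (elim x)
      have "(\<lambda>y. k' (x, y)) \<in> borel_measurable lebesgue"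
        by (intro measurable_completion) measurable
      moreover have "AE y in lebesgue. k' (x, y) = k (x, y)"
        unfolding AE_completion_iff using elim by eventually_elim simp
      ultimately show ?case by (rule borel_measurable_AE)
    qed
  qed
  then show "(\<lambda>y. k (x0, y)) \<in> borel_measurable lebesgue" .
  have comb[measurable]: "section_comb k l \<in> borel_measurable lebesgue" for l
    by (induction l) (use sect in \<open>auto simp: section_comb_def[abs_def]\<close>)

  have k'_int: "integrable (lborel \<Otimes>\<^sub>M lborel) (\<lambda>z. (k' z)\<^sup>2)"
  proof -
    have "integrable lebesgue (\<lambda>z. (k' z)\<^sup>2)"
    proof (rule integrable_cong_AE_imp[OF sq_int])
      show "AE z in lebesgue. (k z)\<^sup>2 = (k' z)\<^sup>2"
        unfolding AE_completion_iff using ae0 by eventually_elim simp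
    qed (intro measurable_completion, measurable)
    then show ?thesis by (subst (asm) integrable_completion) (auto simp: lborel_prod)
  qed
  \<comment> \<open>\<open>K x\<close> is the squared norm of the section of \<open>k'\<close> at
    \<open>x\<close>, and \<open>J\<close> is the squared Hilbert-Schmidt norm of the
    kernel.\<close>
  define K where "K x = (\<integral>y. (k' (x, y))\<^sup>2 \<partial>lborel)" for x
  define J where "J = (\<integral>z. (k' z)\<^sup>2 \<partial>(lborel \<Otimes>\<^sub>M lborel))"
  have K_int: "integrable lborel K" and J: "J = integral\<^sup>L lborel K"
    unfolding K_def[abs_def] J_def
    using lborel_pair.integrable_fst'[OF k'_int] lborel_pair.integral_fst'[OF k'_int] by auto
  have K_meas[measurable]: "K \<in> borel_measurable lborel" using K_int by auto
  have section_sq: "AE x in lborel. integrable lborel (\<lambda>y. (k' (x, y))\<^sup>2)"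
    using lborel_pair.AE_integrable_fst'[OF k'_int] .

  define h where "h y = k (x0, y)" for y
  define c where "c = k (x0, x0)"
  have c0: "0 \<le> c" unfolding c_def by (rule kernel_diagonal_nonneg[OF psd])
  have h_meas[measurable]: "h \<in> borel_measurable lebesgue" unfolding h_def[abs_def] by (rule sect)
  have h_comb: "h = section_comb k [(1, x0)]" and c_energy: "c = kernel_energy k [(1, x0)]"
    by (simp_all add: h_def c_def section_comb_def kernel_energy_def fun_eq_iff)

  \<comment> \<open>The diagonal of \<open>k\<close> need not be measurable, hence the hulls \<open>S m\<close> of its sublevel sets.\<close>
  define D where "D m = {y. k (y, y) \<le> real m \<and> norm y \<le> real m}" for m
  have "\<forall>m. \<exists>S. S \<in> sets lebesgue \<and> D m \<subseteq> S \<and> emeasure lebesgue S < \<infinity> \<and>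
      (\<forall>P. Measurable.pred lebesgue P \<longrightarrow> (\<forall>x\<in>D m. P x) \<longrightarrow> (AE x in lebesgue. x \<in> S \<longrightarrow> P x))"
  proof
    fix m
    obtain S where S: "S \<in> sets lebesgue" "D m \<subseteq> S" "emeasure lebesgue S = outer_measure_of lebesgue (D m)"
      "\<And>P. Measurable.pred lebesgue P \<Longrightarrow> (\<And>x. x \<in> D m \<Longrightarrow> P x) \<Longrightarrow> emeasure lebesgue S < \<infinity> \<Longrightarrow>
         AE x in lebesgue. x \<in> S \<longrightarrow> P x"
      by (rule measurable_hull[of "D m" lebesgue]) auto
    have "outer_measure_of lebesgue (D m) \<le> outer_measure_of lebesgue (cball 0 (real m) :: 'a set)"
      by (rule outer_measure_of_mono) (auto simp: D_def)
    also have "\<dots> < \<infinity>"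
      using emeasure_bounded_finite[of "cball 0 (real m) :: 'a set"] by simp
    finally show "\<exists>S. S \<in> sets lebesgue \<and> D m \<subseteq> S \<and> emeasure lebesgue S < \<infinity> \<and>
      (\<forall>P. Measurable.pred lebesgue P \<longrightarrow> (\<forall>x\<in>D m. P x) \<longrightarrow> (AE x in lebesgue. x \<in> S \<longrightarrow> P x))"
      using S by metis
  qed
  then obtain S where S: "\<And>m. S m \<in> sets lebesgue" "\<And>m. D m \<subseteq> S m" "\<And>m. emeasure lebesgue (S m) < \<infinity>"
    "\<And>m P. Measurable.pred lebesgue P \<Longrightarrow> (\<And>x. x \<in> D m \<Longrightarrow> P x) \<Longrightarrow> AE x in lebesgue. x \<in> S m \<longrightarrow> P x"
    by metis
  \<comment> \<open>The hulls \<open>S m\<close> need not increase with \<open>m\<close>.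
    Intersecting the tail makes the family increasing, and it still contains \<open>D M\<close>
    because the sets \<open>D m\<close> increase.\<close>
  define B where "B M = (\<Inter>m\<in>{M..}. S m)" for M
  have B[measurable]: "B M \<in> sets lebesgue" for M
    unfolding B_def using S(1) by (intro sets.countable_INT) auto
  have B_S: "B M \<subseteq> S M" for M by (auto simp: B_def)
  have D_B: "D M \<subseteq> B M" for M
  proof -
    have "D M \<subseteq> D m" if "M \<le> m" for m using that by (auto simp: D_def)
    then show ?thesis using S(2) by (fastforce simp: B_def)
  qed
  have B_fin: "emeasure lebesgue (B M) < \<infinity>" for M
    using emeasure_mono[OF B_S[of M] S(1)] S(3)[of M] by (rule le_less_trans)
  have B_int: "integrable lebesgue (\<lambda>y. indicator (B M) y * r)" for M and r :: real
    using B_fin[of M] by (intro integrable_mult_left integrable_real_indicator) auto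
  \<comment> \<open>Cauchy-Schwarz gives the inequality everywhere on \<open>D M\<close>; being a
    measurable condition on \<open>y\<close>, it passes to almost all of the hull.\<close>
  have B_bound: "AE y in lebesgue. y \<in> B M \<longrightarrow> (section_comb k l y)\<^sup>2 \<le> real M * kernel_energy k l" for M l
  proof -
    have "AE y in lebesgue. y \<in> S M \<longrightarrow> (section_comb k l y)\<^sup>2 \<le> real M * kernel_energy k l"
    proof (rule S(4))
      fix y assume "y \<in> D M"
      then have "k (y, y) * kernel_energy k l \<le> real M * kernel_energy k l"
        using kernel_energy_nonneg[OF psd] by (intro mult_right_mono) (auto simp: D_def)
      then show "(section_comb k l y)\<^sup>2 \<le> real M * kernel_energy k l"
        using section_comb_squared_le[OF sym psd, of l y] by linarith
    qed measurable
    then show ?thesis by eventually_elim (use B_S in auto)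
  qed

  have main: "integrable lebesgue (\<lambda>y. indicator (B M) y * (h y)\<^sup>2)"
    "(\<integral>y. indicator (B M) y * (h y)\<^sup>2 \<partial>lebesgue) \<le> c * sqrt J" for M
  proof -
    let ?B = "indicator (B M) :: 'a \<Rightarrow> real"
    \<comment> \<open>Young's inequality with a free weight \<open>t\<close>: a large
      \<open>t\<close> makes the coefficient of the energy small, while \<open>t = 1\<close>
      suffices for integrability and domination.\<close>
    have bound: "AE y in lebesgue. \<bar>?B y * (h y * section_comb k l y)\<bar> \<le>
        ?B y * ((t * (real M * c) + (real M * kernel_energy k l) / t) / 2)" if "t > 0" for l t
      using B_bound[of M l] B_bound[of M "[(1, x0)]"]
    proof eventually_elim
      case (elim y)
      show ?case
      proof (cases "y \<in> B M")
        case True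
        have "2 * \<bar>h y * section_comb k l y\<bar> \<le> t * (h y)\<^sup>2 + (section_comb k l y)\<^sup>2 / t"
        proof -
          have "0 \<le> (t * \<bar>h y\<bar> - \<bar>section_comb k l y\<bar>)\<^sup>2" by simp
          then have "t * (2 * \<bar>h y * section_comb k l y\<bar>) \<le> t * (t * (h y)\<^sup>2 + (section_comb k l y)\<^sup>2 / t)"
            using that by (simp add: power2_diff power_mult_distrib abs_mult algebra_simps power2_eq_square)
          then show ?thesis using that by simp
        qed
        also have "\<dots> \<le> t * (real M * c) + (real M * kernel_energy k l) / t"
          using elim True that unfolding h_comb c_energy
          by (intro add_mono mult_left_mono divide_right_mono) auto
        finally show ?thesis using True by simp
      qed simp
    qed
    have int: "integrable lebesgue (\<lambda>y. ?B y * (h y * section_comb k l y))" for l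
    proof (rule Bochner_Integration.integrable_bound[OF B_int])
      show "AE y in lebesgue. norm (?B y * (h y * section_comb k l y)) \<le>
          norm (?B y * ((1 * (real M * c) + (real M * kernel_energy k l) / 1) / 2))"
        using bound[OF zero_less_one, of l]
        by eventually_elim (metis abs_ge_self order_trans real_norm_def)
    qed measurable
    \<comment> \<open>This is the value at the section of \<open>x\<close> of the functional that
      integrates against \<open>h\<close> over \<open>B M\<close>; by linearity,
      \<open>lincomb l \<phi>\<close> is its value at \<open>section_comb k l\<close>.\<close>
    define \<phi> where "\<phi> x = (\<integral>y. ?B y * (h y * k (x, y)) \<partial>lebesgue)" for x
    have int1: "integrable lebesgue (\<lambda>y. ?B y * (h y * k (x, y)))" for x
      using int[of "[(1, x)]"] by (simp add: section_comb_def)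
    have lin: "lincomb l \<phi> = (\<integral>y. ?B y * (h y * section_comb k l y) \<partial>lebesgue)" for l
    proof (induction l)
      case (Cons p l)
      obtain s x where p: "p = (s, x)" by force
      have "(\<integral>y. ?B y * (h y * section_comb k (p # l) y) \<partial>lebesgue) =
          (\<integral>y. s * (?B y * (h y * k (x, y))) + ?B y * (h y * section_comb k l y) \<partial>lebesgue)"
        by (intro Bochner_Integration.integral_cong) (auto simp: p algebra_simps)
      also have "\<dots> = s * \<phi> x + lincomb l \<phi>"
        using int1 int Cons by (subst Bochner_Integration.integral_add) (auto simp: \<phi>_def[of x])
      finally show ?case by (simp add: p)
    qed (simp add: section_comb_def)
    \<comment> \<open>Adding 1 makes \<open>V\<close> positive even if \<open>B M\<close> is null.
      The choice of \<open>t\<close> turns the coefficient of the energy into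
      \<open>real M / (real M + 1)\<close>, which is below 1, so the energy absorbs the linear
      term.\<close>
    define V where "V = measure lebesgue (B M) + 1"
    define t where "t = (real M + 1) * V"
    have V: "V > 0" by (auto simp: V_def add_nonneg_pos)
    then have t: "t > 0" by (auto simp: t_def)
    have "- (V * (t * (real M * c))) \<le> section_functional k \<phi> l" for l
    proof -
      let ?r = "(t * (real M * c) + (real M * kernel_energy k l) / t) / 2"
      have r0: "0 \<le> ?r" using t c0 kernel_energy_nonneg[OF psd, of l] by auto
      have "\<bar>lincomb l \<phi>\<bar> \<le> (\<integral>y. \<bar>?B y * (h y * section_comb k l y)\<bar> \<partial>lebesgue)"
        unfolding lin by (rule integral_abs_bound)
      also have "\<dots> \<le> (\<integral>y. ?B y * ?r \<partial>lebesgue)"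
        by (rule integral_mono_AE[OF integrable_abs[OF int] B_int bound[OF t]])
      also have "\<dots> = measure lebesgue (B M) * ?r" by simp
      also have "\<dots> \<le> V * ?r" using r0 by (intro mult_right_mono) (auto simp: V_def)
      finally have "2 * \<bar>lincomb l \<phi>\<bar> \<le> V * (t * (real M * c)) + V * ((real M * kernel_energy k l) / t)"
        by (simp add: algebra_simps)
      also have "V * ((real M * kernel_energy k l) / t) = real M / (real M + 1) * kernel_energy k l"
        using V by (simp add: t_def)
      also have "\<dots> \<le> 1 * kernel_energy k l"
        using kernel_energy_nonneg[OF psd, of l] by (intro mult_right_mono) auto
      finally show ?thesis by (simp add: section_functional_def)
    qed
    then obtain m l where m: "\<And>l. m \<le> section_functional k \<phi> l"
      and lim: "\<And>y. (\<lambda>n. section_comb k (l n) y) \<longlonglongrightarrow> \<phi> y"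
      and bdd: "bounded (range (\<lambda>n. kernel_energy k (l n)))"
      and lim_m: "(\<lambda>n. lincomb (l n) \<phi>) \<longlonglongrightarrow> - m"
      using section_functional_minimizing_sequence[OF sym psd, of UNIV "- (V * (t * (real M * c)))" \<phi>]
      by (metis subset_UNIV UNIV_I)
    obtain R where R: "\<And>n. kernel_energy k (l n) \<le> R"
      using bdd unfolding bounded_iff by (metis abs_le_D1 rangeI real_norm_def)
    have \<phi>_meas[measurable]: "\<phi> \<in> borel_measurable lebesgue"
      by (rule borel_measurable_LIMSEQ_real[OF lim comb])
    \<comment> \<open>The uniform energy bound \<open>R\<close> provides a constant that dominates
      on the set \<open>B M\<close> of finite measure, so the pointwise limit can be taken under the
      integral.\<close>
    have dom: "AE y in lebesgue. norm (?B y * (h y * section_comb k (l n) y)) \<le>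
        ?B y * ((real M * c + real M * R) / 2)" for n
      using bound[OF zero_less_one, of "l n"]
    proof eventually_elim
      case (elim y)
      have "real M * kernel_energy k (l n) \<le> real M * R" using R by (intro mult_left_mono) auto
      then show ?case using elim by (auto simp: indicator_def)
    qed
    have lim_ae: "AE y in lebesgue. (\<lambda>n. ?B y * (h y * section_comb k (l n) y)) \<longlonglongrightarrow> ?B y * (h y * \<phi> y)"
      by (intro always_eventually allI tendsto_mult tendsto_const lim)
    have h\<phi>_int: "integrable lebesgue (\<lambda>y. ?B y * (h y * \<phi> y))"
      by (rule integrable_dominated_convergence[OF _ _ B_int lim_ae dom]) measurable
    have lim_int: "(\<lambda>n. \<integral>y. ?B y * (h y * section_comb k (l n) y) \<partial>lebesgue) \<longlonglongrightarrow> (\<integral>y. ?B y * (h y * \<phi> y) \<partial>lebesgue)"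
      by (rule integral_dominated_convergence[OF _ _ B_int lim_ae dom]) measurable
    have m_eq: "- m = (\<integral>y. ?B y * (h y * \<phi> y) \<partial>lebesgue)"
      by (rule LIMSEQ_unique[OF lim_m[unfolded lin] lim_int])
    define I where "I = (\<integral>y. ?B y * (h y)\<^sup>2 \<partial>lebesgue)"
    have I_int: "integrable lebesgue (\<lambda>y. ?B y * (h y)\<^sup>2)"
      using int1[of x0] by (simp add: h_def power2_eq_square)
    have I0: "0 \<le> I" unfolding I_def by (rule integral_nonneg_AE) auto
    have \<phi>x0: "\<phi> x0 = I" by (simp add: \<phi>_def I_def h_def power2_eq_square)
    \<comment> \<open>The minimum is tested against multiples of the single section at
      \<open>x0\<close>, where the functional is \<open>s\<^sup>2 * c - 2 * s * I\<close>.\<close>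
    have I1: "I\<^sup>2 \<le> c * (- m)"
    proof -
      have "(- I)\<^sup>2 \<le> c * (- m)"
      proof (rule quadratic_nonneg_discriminant)
        fix s show "0 \<le> s\<^sup>2 * c + 2 * s * - I + - m"
          using m[of "[(s, x0)]"]
          by (simp add: section_functional_def kernel_energy_def \<phi>x0 c_def power2_eq_square mult_ac)
      qed
      then show ?thesis by simp
    qed
    \<comment> \<open>By \<open>m_eq\<close>, \<open>- m\<close> is an iterated integral of
      \<open>h k h\<close>. Young's inequality with weight \<epsilon> separates the kernel from the
      product of the two values of \<open>h\<close>; the inner integral is estimated for almost
      every \<open>x\<close>, then the outer one.\<close>
    have I2: "- m \<le> (\<epsilon> * I\<^sup>2 + J / \<epsilon>) / 2" if \<epsilon>: "\<epsilon> > 0" for \<epsilon>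
    proof -
      have "AE x in lebesgue. ?B x * (h x * \<phi> x) \<le> (\<epsilon> * (?B x * (h x)\<^sup>2) * I + K x / \<epsilon>) / 2"
        unfolding AE_completion_iff using ae section_sq
      proof eventually_elim
        case (elim x)
        have ky: "AE y in lebesgue. k (x, y) = k' (x, y)"
          unfolding AE_completion_iff by (rule elim)
        have k'_meas: "(\<lambda>y. (k' (x, y))\<^sup>2) \<in> borel_measurable lborel" by measurable
        have k'_int: "integrable lebesgue (\<lambda>y. (k' (x, y))\<^sup>2)"
          using elim(2) integrable_completion[OF k'_meas] by simp
        have Kx: "K x = (\<integral>y. (k' (x, y))\<^sup>2 \<partial>lebesgue)"
          using integral_completion[OF k'_meas] by (simp add: K_def)
        have "?B x * (h x * \<phi> x) = (\<integral>y. ?B x * h x * (?B y * (h y * k (x, y))) \<partial>lebesgue)"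
          by (subst integral_mult_right_zero) (simp add: \<phi>_def)
        also have "\<dots> \<le> (\<integral>y. (\<epsilon> * (?B x * (h x)\<^sup>2) * (?B y * (h y)\<^sup>2) + (k' (x, y))\<^sup>2 / \<epsilon>) / 2 \<partial>lebesgue)"
        proof (rule integral_mono_AE)
          show "AE y in lebesgue. ?B x * h x * (?B y * (h y * k (x, y))) \<le>
              (\<epsilon> * (?B x * (h x)\<^sup>2) * (?B y * (h y)\<^sup>2) + (k' (x, y))\<^sup>2 / \<epsilon>) / 2"
            using ky
          proof eventually_elim
            case (elim y)
            define u where "u = ?B x * h x * (?B y * h y)"
            have u2: "u\<^sup>2 = (?B x * (h x)\<^sup>2) * (?B y * (h y)\<^sup>2)"
              by (auto simp: u_def indicator_def power_mult_distrib)
            have "0 \<le> (\<epsilon> * u - k' (x, y))\<^sup>2" by simp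
            then have "\<epsilon> * (2 * (u * k' (x, y))) \<le> \<epsilon> * (\<epsilon> * u\<^sup>2 + (k' (x, y))\<^sup>2 / \<epsilon>)"
              using \<epsilon> by (simp add: power2_diff power_mult_distrib algebra_simps power2_eq_square)
            then have "2 * (u * k' (x, y)) \<le> \<epsilon> * u\<^sup>2 + (k' (x, y))\<^sup>2 / \<epsilon>" using \<epsilon> by simp
            then show ?case unfolding u2 elim by (simp add: u_def mult_ac)
          qed
        qed (use int1 I_int k'_int in auto)
        also have "\<dots> = (\<epsilon> * (?B x * (h x)\<^sup>2) * I + K x / \<epsilon>) / 2"
          using I_int k'_int by (simp add: Kx I_def)
        finally show ?case .
      qed
      then have "- m \<le> (\<integral>x. (\<epsilon> * (?B x * (h x)\<^sup>2) * I + K x / \<epsilon>) / 2 \<partial>lebesgue)"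
        unfolding m_eq using h\<phi>_int I_int K_int
        by (intro integral_mono_AE) (auto simp: integrable_completion)
      also have "\<dots> = (\<epsilon> * I\<^sup>2 + J / \<epsilon>) / 2"
        using I_int K_int
        by (simp add: integrable_completion integral_completion J I_def power2_eq_square)
      finally show ?thesis .
    qed
    have "I\<^sup>2 \<le> c\<^sup>2 * J"
    proof (cases "c = 0")
      case False
      then have c: "c > 0" using c0 by simp
      \<comment> \<open>The weight \<open>1 / c\<close> leaves the coefficient 1/2 on
        \<open>I\<^sup>2\<close>, which the left side absorbs.\<close>
      have "I\<^sup>2 \<le> c * ((1 / c * I\<^sup>2 + J / (1 / c)) / 2)"
        using I1 mult_left_mono[OF I2[of "1 / c"] c0] c by simp
      also have "\<dots> = (I\<^sup>2 + c\<^sup>2 * J) / 2" using c by (simp add: field_simps power2_eq_square)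
      finally show ?thesis by simp
    qed (use I1 in simp)
    then have "sqrt (I\<^sup>2) \<le> sqrt (c\<^sup>2 * J)" by (rule real_sqrt_le_mono)
    then show "integrable lebesgue (\<lambda>y. indicator (B M) y * (h y)\<^sup>2)"
      "(\<integral>y. indicator (B M) y * (h y)\<^sup>2 \<partial>lebesgue) \<le> c * sqrt J"
      using I_int I0 c0 by (auto simp: I_def real_sqrt_mult)
  qed

  have B_mono: "B M \<subseteq> B N" if "M \<le> N" for M N
    using that by (auto simp: B_def)
  have B_le: "indicator (B M) y * (h y)\<^sup>2 \<le> indicator (B N) y * (h y)\<^sup>2" if "M \<le> N" for M N y
    using B_mono[OF that] by (auto simp: indicator_def)
  define F where "F M = (\<integral>y. indicator (B M) y * (h y)\<^sup>2 \<partial>lebesgue)" for M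
  have "incseq F"
    unfolding F_def incseq_def using main(1) B_le by (intro allI impI integral_mono) auto
  moreover have "\<forall>M. F M \<le> c * sqrt J"
    using main(2) by (simp add: F_def)
  ultimately obtain L where L: "F \<longlonglongrightarrow> L" and "\<forall>M. F M \<le> L"
    by (metis incseq_convergent)
  \<comment> \<open>The bound on the integrals over \<open>B M\<close> is uniform in
    \<open>M\<close>, and every \<open>y\<close> lies in \<open>B M\<close> for large
    \<open>M\<close>, so monotone convergence applies.\<close>
  have "integrable lebesgue (\<lambda>y. (h y)\<^sup>2)"
  proof (rule integral_monotone_convergence_nonneg)
    show "AE y in lebesgue. mono (\<lambda>M. indicator (B M) y * (h y)\<^sup>2)"
      using B_le by (intro always_eventually allI monoI)
    show "AE y in lebesgue. (\<lambda>M. indicator (B M) y * (h y)\<^sup>2) \<longlonglongrightarrow> (h y)\<^sup>2"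
    proof (rule always_eventually, rule allI, rule tendsto_eventually)
      fix y
      obtain M where M: "max (k (y, y)) (norm y) \<le> real M" using real_arch_simple by blast
      then have "y \<in> B M" using D_B[of M] by (auto simp: D_def)
      then show "\<forall>\<^sub>F M in sequentially. indicator (B M) y * (h y)\<^sup>2 = (h y)\<^sup>2"
        using B_mono by (intro eventually_sequentiallyI[of M]) (auto simp: indicator_def subset_iff)
    qed
    show "(\<lambda>M. \<integral>y. indicator (B M) y * (h y)\<^sup>2 \<partial>lebesgue) \<longlonglongrightarrow> L" using L by (simp add: F_def[abs_def])
  qed (use main(1) in auto)
  then show "integrable lebesgue (\<lambda>y. (k (x0, y))\<^sup>2)" by (simp add: h_def)
qed

text \<open>Extension by zero outside \<open>A \<times> A\<close> preserves symmetry, positive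
  semi-definiteness and square-integrability, which reduces the claim to the whole space.\<close>

lemma kernel_section_L2:
  fixes k :: "'a::euclidean_space \<times> 'a \<Rightarrow> real"
  assumes A: "A \<in> sets lebesgue" "A \<times> A \<in> sets lebesgue"
    and sym: "sym_kernel_on A k" and psd: "psd_kernel_on A k" and L2: "k \<in> L2_fun (A \<times> A)"
    and z: "z \<in> A"
  shows "(\<lambda>y. k (y, z)) \<in> borel_measurable (lebesgue_on A)"
    and "integrable (lebesgue_on A) (\<lambda>y. (k (y, z))\<^sup>2)"
proof -
  define K where "K p = (if p \<in> A \<times> A then k p else 0)" for p
  have K_sym: "sym_kernel_on UNIV K"
    using sym by (auto simp: sym_kernel_on_def K_def)
  have K_psd: "psd_kernel_on UNIV K"
    unfolding psd_kernel_on_def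
  proof (intro allI impI)
    fix N :: nat and x :: "nat \<Rightarrow> 'a" and c :: "nat \<Rightarrow> real"
    \<comment> \<open>The hypothesis speaks only of points of \<open>A\<close>: a point outside is
      replaced by \<open>z\<close>, and its coefficient is set to zero.\<close>
    define x' where "x' i = (if x i \<in> A then x i else z)" for i
    define c' where "c' i = (if x i \<in> A then c i else 0)" for i
    have "0 \<le> (\<Sum>i<N. \<Sum>j<N. c' i * c' j * k (x' i, x' j))"
      using psd[unfolded psd_kernel_on_def, rule_format, of N x' c'] z by (auto simp: x'_def)
    also have "\<dots> = (\<Sum>i<N. \<Sum>j<N. c i * c j * K (x i, x j))"
      by (intro sum.cong refl) (auto simp: K_def x'_def c'_def)
    finally show "0 \<le> (\<Sum>i<N. \<Sum>j<N. c i * c j * K (x i, x j))" .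
  qed
  have K_meas: "K \<in> borel_measurable lebesgue"
    using L2 borel_measurable_if_lebesgue_on[OF A(2), of UNIV k]
    by (simp add: L2_fun_def K_def[abs_def] lebesgue_on_UNIV_eq)
  have K_int: "integrable lebesgue (\<lambda>p. (K p)\<^sup>2)"
  proof -
    have "integrable lebesgue (\<lambda>p. indicator (A \<times> A) p *\<^sub>R (k p)\<^sup>2)"
      using L2 A by (subst integrable_restrict_space[symmetric]) (auto simp: L2_fun_def)
    also have "(\<lambda>p. indicator (A \<times> A) p *\<^sub>R (k p)\<^sup>2) = (\<lambda>p. (K p)\<^sup>2)"
      by (auto simp: K_def fun_eq_iff)
    finally show ?thesis .
  qed
  have eq: "K (z, y) = (if y \<in> A then k (y, z) else 0)" for y
    using sym z by (auto simp: K_def sym_kernel_on_def)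
  have meas: "(\<lambda>y. if y \<in> A then k (y, z) else 0) \<in> borel_measurable (lebesgue_on UNIV)"
    using kernel_section_square_integrable(1)[OF K_sym K_psd K_meas K_int, of z]
    by (simp add: eq lebesgue_on_UNIV_eq)
  then show "(\<lambda>y. k (y, z)) \<in> borel_measurable (lebesgue_on A)"
    using borel_measurable_if_lebesgue_on[OF A(1), of UNIV "\<lambda>y. k (y, z)"] by simp
  have "integrable lebesgue (\<lambda>y. (K (z, y))\<^sup>2)"
    by (rule kernel_section_square_integrable(2)[OF K_sym K_psd K_meas K_int])
  also have "(\<lambda>y. (K (z, y))\<^sup>2) = (\<lambda>y. indicator A y *\<^sub>R (k (y, z))\<^sup>2)"
    by (auto simp: eq fun_eq_iff)
  finally show "integrable (lebesgue_on A) (\<lambda>y. (k (y, z))\<^sup>2)"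
    using A by (subst integrable_restrict_space) auto
qed

section \<open>Finite sums of square-integrable functions\<close>

lemma square_integrable_add:
  fixes f g :: "'a \<Rightarrow> real"
  assumes [measurable]: "f \<in> borel_measurable M" "g \<in> borel_measurable M"
    and "integrable M (\<lambda>x. (f x)\<^sup>2)" "integrable M (\<lambda>x. (g x)\<^sup>2)"
  shows "integrable M (\<lambda>x. (f x + g x)\<^sup>2)"
proof (rule Bochner_Integration.integrable_bound)
  show "integrable M (\<lambda>x. 2 * (f x)\<^sup>2 + 2 * (g x)\<^sup>2)" using assms by simp
  have "(f x + g x)\<^sup>2 \<le> 2 * (f x)\<^sup>2 + 2 * (g x)\<^sup>2" for x
    using zero_le_power2[of "f x - g x"] by (simp add: power2_sum power2_diff)
  then show "AE x in M. norm ((f x + g x)\<^sup>2) \<le> norm (2 * (f x)\<^sup>2 + 2 * (g x)\<^sup>2)" by simp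
qed measurable

lemma square_integrable_add_sum:
  fixes f :: "'a \<Rightarrow> real" and g :: "'i \<Rightarrow> 'a \<Rightarrow> real"
  assumes "finite P" "f \<in> borel_measurable M" "integrable M (\<lambda>x. (f x)\<^sup>2)"
    and "\<And>i. i \<in> P \<Longrightarrow> g i \<in> borel_measurable M" "\<And>i. i \<in> P \<Longrightarrow> integrable M (\<lambda>x. (g i x)\<^sup>2)"
  shows "(\<lambda>x. f x + (\<Sum>i\<in>P. g i x * c i)) \<in> borel_measurable M \<and>
    integrable M (\<lambda>x. (f x + (\<Sum>i\<in>P. g i x * c i))\<^sup>2)"
  using assms
proof (induction P rule: finite_induct)
  case (insert p P)
  then have IH: "(\<lambda>x. f x + (\<Sum>i\<in>P. g i x * c i)) \<in> borel_measurable M"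
      "integrable M (\<lambda>x. (f x + (\<Sum>i\<in>P. g i x * c i))\<^sup>2)"
    and p: "(\<lambda>x. g p x * c p) \<in> borel_measurable M" "integrable M (\<lambda>x. (g p x * c p)\<^sup>2)"
    by (auto simp: power_mult_distrib)
  have eq: "f x + (\<Sum>i\<in>insert p P. g i x * c i) = (f x + (\<Sum>i\<in>P. g i x * c i)) + g p x * c p" for x
    using insert.hyps by simp
  show ?case
    unfolding eq
    using borel_measurable_add[OF IH(1) p(1)] square_integrable_add[OF IH(1) p(1) IH(2) p(2)] by (rule conjI)
qed auto

section \<open>Finite Lipschitz systems of ordinary differential equations\<close>

text \<open>The intervals of radius \<open>2 * C / 2 ^ n\<close> around \<open>a n\<close> are
  nested, because consecutive radii differ by exactly the allowed increment
  \<open>C / 2 ^ n\<close>. Their common point is the limit, and the explicit rate is what the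
  Picard iteration uses.\<close>

lemma geometric_increments_converge:
  fixes a :: "nat \<Rightarrow> real"
  assumes "\<And>n. \<bar>a (Suc n) - a n\<bar> \<le> C / 2 ^ n"
  obtains L where "\<And>n. \<bar>L - a n\<bar> \<le> 2 * C / 2 ^ n"
proof -
  have C: "0 \<le> C" using assms[of 0] by simp
  have step: "\<bar>a (Suc n) - a n\<bar> \<le> 2 * C / 2 ^ n - 2 * C / 2 ^ Suc n" for n
    using assms[of n] by (simp add: field_simps)
  have "(\<lambda>n. 4 * C * (1 / 2) ^ n) \<longlonglongrightarrow> 0"
    by (intro tendsto_mult_right_zero LIMSEQ_power_zero) auto
  then have "(\<lambda>n. (a n - 2 * C / 2 ^ n) - (a n + 2 * C / 2 ^ n)) \<longlonglongrightarrow> 0"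
    using tendsto_minus[of "\<lambda>n. 4 * C * (1 / 2) ^ n" 0 sequentially] by (simp add: power_divide)
  then have "\<exists>L. ((\<forall>n. a n - 2 * C / 2 ^ n \<le> L) \<and> (\<lambda>n. a n - 2 * C / 2 ^ n) \<longlonglongrightarrow> L) \<and>
      ((\<forall>n. L \<le> a n + 2 * C / 2 ^ n) \<and> (\<lambda>n. a n + 2 * C / 2 ^ n) \<longlonglongrightarrow> L)"
  proof (intro nested_sequence_unique allI)
    fix n
    show "a n - 2 * C / 2 ^ n \<le> a (Suc n) - 2 * C / 2 ^ Suc n"
      "a (Suc n) + 2 * C / 2 ^ Suc n \<le> a n + 2 * C / 2 ^ n"
      using step[of n] by linarith+
    have "0 \<le> 2 * C / 2 ^ n" using C by simp
    then show "a n - 2 * C / 2 ^ n \<le> a n + 2 * C / 2 ^ n" by linarith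
  qed
  then obtain L where "\<And>n. a n - 2 * C / 2 ^ n \<le> L" "\<And>n. L \<le> a n + 2 * C / 2 ^ n"
    by blast
  then show thesis by (intro that[of L]) (simp add: abs_le_iff algebra_simps)
qed

lemma le_geometric_imp_zero:
  fixes d C :: real
  assumes "\<And>n. \<bar>d\<bar> \<le> C / 2 ^ n"
  shows "d = 0"
proof -
  have "(\<lambda>n. C * (1 / 2) ^ n) \<longlonglongrightarrow> 0"
    by (intro tendsto_mult_right_zero LIMSEQ_power_zero) auto
  then have "\<bar>d\<bar> \<le> 0"
    using assms by (intro LIMSEQ_le_const) (auto simp: power_divide)
  then show ?thesis by simp
qed

text \<open>The condition \<open>lip\<close> is a Lipschitz bound in the supremum norm over
  \<open>P\<close>. Taking \<open>B = 0\<close> shows that \<open>V u x\<close> depends only on the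
  values of \<open>u\<close> on \<open>P\<close>.\<close>

locale finite_lipschitz_field =
  fixes P :: "'a set" and V :: "('a \<Rightarrow> real) \<Rightarrow> 'a \<Rightarrow> real" and \<Lambda> :: real
  assumes finite: "finite P" and pos: "0 < \<Lambda>"
    and lip: "\<And>x u v B. x \<in> P \<Longrightarrow> (\<And>z. z \<in> P \<Longrightarrow> \<bar>u z - v z\<bar> \<le> B) \<Longrightarrow> \<bar>V u x - V v x\<bar> \<le> \<Lambda> * B"
begin

lemma continuous_on_field:
  assumes "\<And>z. z \<in> P \<Longrightarrow> continuous_on S (\<lambda>s. u s z)" and x: "x \<in> P"
  shows "continuous_on S (\<lambda>s. V (u s) x)"
  unfolding continuous_on_def
proof
  fix s assume s: "s \<in> S"
  have lim: "((\<lambda>r. \<Lambda> * (\<Sum>z\<in>P. \<bar>u r z - u s z\<bar>)) \<longlongrightarrow> 0) (at s within S)"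
    using assms(1) s unfolding continuous_on_def
    by (intro tendsto_mult_right_zero tendsto_null_sum tendsto_rabs_zero LIM_zero) auto
  have "norm (V (u r) x - V (u s) x) \<le> \<Lambda> * (\<Sum>z\<in>P. \<bar>u r z - u s z\<bar>)" for r
    unfolding real_norm_def
  proof (rule lip[OF x])
    show "\<bar>u r z - u s z\<bar> \<le> (\<Sum>z\<in>P. \<bar>u r z - u s z\<bar>)" if "z \<in> P" for z
      by (rule member_le_sum[OF that _ finite]) simp
  qed
  then have "((\<lambda>r. V (u r) x - V (u s) x) \<longlongrightarrow> 0) (at s within S)"
    by (intro Lim_null_comparison[OF _ lim] always_eventually allI)
  then show "((\<lambda>s. V (u s) x) \<longlongrightarrow> V (u s) x) (at s within S)"
    by (rule LIM_zero_cancel)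
qed

text \<open>The weight \<open>exp (2 * \<Lambda> * t)\<close> makes the Picard map a contraction with factor 1/2 on all of \<open>[0, \<infinity>)\<close>.\<close>

lemma picard_contraction:
  assumes u: "\<And>z. z \<in> P \<Longrightarrow> continuous_on {0..t} (\<lambda>s. u s z)"
    and v: "\<And>z. z \<in> P \<Longrightarrow> continuous_on {0..t} (\<lambda>s. v s z)"
    and le: "\<And>s z. 0 \<le> s \<Longrightarrow> s \<le> t \<Longrightarrow> z \<in> P \<Longrightarrow> \<bar>u s z - v s z\<bar> \<le> K * exp (2 * \<Lambda> * s)"
    and x: "x \<in> P" and t: "0 \<le> t" and K: "0 \<le> K"
  shows "\<bar>integral {0..t} (\<lambda>s. V (u s) x) - integral {0..t} (\<lambda>s. V (v s) x)\<bar> \<le> K / 2 * exp (2 * \<Lambda> * t)"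
proof -
  have cont: "continuous_on {0..t} (\<lambda>s. V (u s) x)" "continuous_on {0..t} (\<lambda>s. V (v s) x)"
    using u v x by (auto intro: continuous_on_field)
  have "((\<lambda>s. \<Lambda> * (K * exp (2 * \<Lambda> * s))) has_integral
      (K / 2 * exp (2 * \<Lambda> * t) - K / 2 * exp (2 * \<Lambda> * 0))) {0..t}"
    by (intro fundamental_theorem_of_calculus t)
       (auto intro!: derivative_eq_intros simp: has_real_derivative_iff_has_vector_derivative[symmetric])
  then have int: "(\<lambda>s. \<Lambda> * (K * exp (2 * \<Lambda> * s))) integrable_on {0..t}"
    "integral {0..t} (\<lambda>s. \<Lambda> * (K * exp (2 * \<Lambda> * s))) \<le> K / 2 * exp (2 * \<Lambda> * t)"
    using K by (auto dest: integral_unique)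
  have "\<bar>integral {0..t} (\<lambda>s. V (u s) x) - integral {0..t} (\<lambda>s. V (v s) x)\<bar> =
      norm (integral {0..t} (\<lambda>s. V (u s) x - V (v s) x))"
    using cont by (simp add: integral_diff integrable_continuous_real)
  also have "\<dots> \<le> integral {0..t} (\<lambda>s. \<Lambda> * (K * exp (2 * \<Lambda> * s)))"
  proof (rule integral_norm_bound_integral)
    show "(\<lambda>s. V (u s) x - V (v s) x) integrable_on {0..t}"
      using cont by (intro integrable_diff integrable_continuous_real)
    show "norm (V (u s) x - V (v s) x) \<le> \<Lambda> * (K * exp (2 * \<Lambda> * s))" if "s \<in> {0..t}" for s
      using that le x by (auto intro: lip)
  qed (rule int(1))
  finally show ?thesis using int(2) by linarith
qed

text \<open>The integral form of the initial value problem, so that solutions are the continuous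
  fixed points of the Picard map.\<close>

definition solves :: "('a \<Rightarrow> real) \<Rightarrow> (real \<Rightarrow> 'a \<Rightarrow> real) \<Rightarrow> bool" where
  "solves u0 u \<longleftrightarrow> (\<forall>x\<in>P. \<forall>t\<ge>0. continuous_on {0..t} (\<lambda>s. u s x) \<and>
     u t x = u0 x + integral {0..t} (\<lambda>s. V (u s) x))"

lemma solves_unique:
  assumes u: "solves u0 u" and v: "solves u0 v" and x: "x \<in> P" and t: "0 \<le> t"
  shows "u t x = v t x"
proof -
  have cont: "continuous_on {0..s} (\<lambda>s. u s z)" "continuous_on {0..s} (\<lambda>s. v s z)"
    if "z \<in> P" "0 \<le> s" for s z
    using u v that by (auto simp: solves_def)
  have "compact ((\<lambda>s. \<Sum>z\<in>P. \<bar>u s z - v s z\<bar>) ` {0..t})"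
    by (intro compact_continuous_image continuous_intros cont t) auto
  then have "bounded ((\<lambda>s. \<Sum>z\<in>P. \<bar>u s z - v s z\<bar>) ` {0..t})"
    by (rule compact_imp_bounded)
  then obtain K where "\<forall>y\<in>(\<lambda>s. \<Sum>z\<in>P. \<bar>u s z - v s z\<bar>) ` {0..t}. norm y \<le> K"
    unfolding bounded_iff by blast
  then have K: "\<bar>\<Sum>z\<in>P. \<bar>u s z - v s z\<bar>\<bar> \<le> K" if "s \<in> {0..t}" for s
    using that by auto
  have K0: "0 \<le> K" using order_trans[OF abs_ge_zero K[of 0]] t by simp
  \<comment> \<open>Both functions are fixed by the Picard map, so each application of the
    contraction halves the weighted bound on their difference; the start is a crude bound by
    compactness.\<close>
  have bound: "\<bar>u s z - v s z\<bar> \<le> K / 2 ^ n * exp (2 * \<Lambda> * s)" if "0 \<le> s" "s \<le> t" "z \<in> P" for n s z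
    using that
  proof (induction n arbitrary: s z)
    case 0
    have "\<bar>u s z - v s z\<bar> \<le> (\<Sum>z\<in>P. \<bar>u s z - v s z\<bar>)"
      using 0 finite by (intro member_le_sum) auto
    also have "\<dots> \<le> K * 1" using K[of s] 0 by auto
    also have "\<dots> \<le> K * exp (2 * \<Lambda> * s)"
      using K0 0 pos by (intro mult_left_mono) auto
    finally show ?case by simp
  next
    case (Suc n)
    have "u s z = u0 z + integral {0..s} (\<lambda>s. V (u s) z)" "v s z = u0 z + integral {0..s} (\<lambda>s. V (v s) z)"
      using u v Suc.prems unfolding solves_def by blast+
    moreover have "\<bar>integral {0..s} (\<lambda>s. V (u s) z) - integral {0..s} (\<lambda>s. V (v s) z)\<bar> \<le>
        K / 2 ^ n / 2 * exp (2 * \<Lambda> * s)"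
      using Suc K0 by (intro picard_contraction cont) auto
    ultimately show ?case by simp
  qed
  have "u t x - v t x = 0"
    by (rule le_geometric_imp_zero[of _ "K * exp (2 * \<Lambda> * t)"]) (use bound[of t x] x t in simp)
  then show ?thesis by simp
qed

fun picard :: "('a \<Rightarrow> real) \<Rightarrow> nat \<Rightarrow> real \<Rightarrow> 'a \<Rightarrow> real" where
  "picard u0 0 t x = u0 x"
| "picard u0 (Suc n) t x = u0 x + integral {0..t} (\<lambda>s. V (picard u0 n s) x)"

lemma continuous_on_picard:
  assumes "x \<in> P"
  shows "continuous_on {0..t} (\<lambda>s. picard u0 n s x)"
  using assms
proof (induction n arbitrary: x)
  case (Suc n)
  then have "continuous_on {0..t} (\<lambda>s. V (picard u0 n s) x)"
    by (intro continuous_on_field)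
  then show ?case
    by (auto intro!: continuous_intros indefinite_integral_continuous_1 integrable_continuous_real)
qed simp

lemma exists_solution: "\<exists>u. solves u0 u"
proof -
  \<comment> \<open>The first increment is \<open>t * V u0 x\<close>, and
    \<open>2 * \<Lambda> * t \<le> exp (2 * \<Lambda> * t)\<close> bounds it by \<open>K\<close>
    times the weight.\<close>
  define K where "K = (\<Sum>x\<in>P. \<bar>V u0 x\<bar>) / (2 * \<Lambda>)"
  have K0: "0 \<le> K" unfolding K_def using pos by (intro divide_nonneg_nonneg sum_nonneg) auto
  have step: "\<bar>picard u0 (Suc n) t x - picard u0 n t x\<bar> \<le> K / 2 ^ n * exp (2 * \<Lambda> * t)"
    if "0 \<le> t" "x \<in> P" for n t x
    using that
  proof (induction n arbitrary: t x)
    case 0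
    have "\<bar>V u0 x\<bar> \<le> (\<Sum>x\<in>P. \<bar>V u0 x\<bar>)"
      using 0 finite by (intro member_le_sum) auto
    moreover have "2 * \<Lambda> * t \<le> exp (2 * \<Lambda> * t)"
      using exp_ge_add_one_self[of "2 * \<Lambda> * t"] by linarith
    ultimately have "\<bar>V u0 x\<bar> * (2 * \<Lambda> * t) \<le> (\<Sum>x\<in>P. \<bar>V u0 x\<bar>) * exp (2 * \<Lambda> * t)"
      using 0 pos by (intro mult_mono) (auto intro: sum_nonneg)
    then have "\<bar>t * V u0 x\<bar> \<le> K * exp (2 * \<Lambda> * t)"
      using 0 pos by (simp add: K_def field_simps abs_mult)
    moreover have "picard u0 0 s = u0" for s by (simp add: fun_eq_iff)
    then have "picard u0 (Suc 0) t x - picard u0 0 t x = t * V u0 x"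
      using 0 by simp
    ultimately show ?case by simp
  next
    case (Suc n)
    have "\<bar>integral {0..t} (\<lambda>s. V (picard u0 (Suc n) s) x) - integral {0..t} (\<lambda>s. V (picard u0 n s) x)\<bar> \<le>
        K / 2 ^ n / 2 * exp (2 * \<Lambda> * t)"
      by (intro picard_contraction continuous_on_picard Suc) (use K0 in auto)
    then show ?case by simp
  qed
  have "\<exists>L. \<forall>n. \<bar>L - picard u0 n t x\<bar> \<le> 2 * (K * exp (2 * \<Lambda> * t)) / 2 ^ n" if "0 \<le> t" "x \<in> P" for t x
    using geometric_increments_converge[of "\<lambda>n. picard u0 n t x" "K * exp (2 * \<Lambda> * t)"] step[OF that]
    by (metis times_divide_eq_left)
  then obtain u where u: "\<And>t x n. 0 \<le> t \<Longrightarrow> x \<in> P \<Longrightarrow>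
      \<bar>u t x - picard u0 n t x\<bar> \<le> 2 * (K * exp (2 * \<Lambda> * t)) / 2 ^ n"
    by metis
  have cont: "continuous_on {0..t} (\<lambda>s. u s x)" if "x \<in> P" for t x
  proof (rule uniform_limit_theorem[of _ "\<lambda>n s. picard u0 n s x" sequentially])
    show "\<forall>\<^sub>F n in sequentially. continuous_on {0..t} (\<lambda>s. picard u0 n s x)"
      using that by (simp add: continuous_on_picard)
    have lim: "(\<lambda>n. 2 * (K * exp (2 * \<Lambda> * t)) * (1 / 2) ^ n) \<longlonglongrightarrow> 0"
      by (intro tendsto_mult_right_zero LIMSEQ_power_zero) auto
    have le: "\<bar>picard u0 n s x - u s x\<bar> \<le> 2 * (K * exp (2 * \<Lambda> * t)) * (1 / 2) ^ n"
      if "s \<in> {0..t}" for n s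
    proof -
      have "\<bar>u s x - picard u0 n s x\<bar> \<le> 2 * (K * exp (2 * \<Lambda> * s)) / 2 ^ n"
        using u that \<open>x \<in> P\<close> by auto
      also have "\<dots> \<le> 2 * (K * exp (2 * \<Lambda> * t)) / 2 ^ n"
        using that pos K0 by (intro divide_right_mono mult_left_mono) auto
      finally show ?thesis by (simp add: power_divide abs_minus_commute)
    qed
    show "uniform_limit {0..t} (\<lambda>n s. picard u0 n s x) (\<lambda>s. u s x) sequentially"
    proof (rule uniform_limitI)
      fix e :: real assume "0 < e"
      from order_tendstoD(2)[OF lim this]
      show "\<forall>\<^sub>F n in sequentially. \<forall>s\<in>{0..t}. dist (picard u0 n s x) (u s x) < e"
        by eventually_elim (unfold dist_real_def, blast intro: le_less_trans[OF le])
    qed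
  qed auto
  have "u t x = u0 x + integral {0..t} (\<lambda>s. V (u s) x)" if t: "0 \<le> t" and x: "x \<in> P" for t x
  proof -
    \<comment> \<open>The fixed-point defect is split at \<open>picard u0 (Suc n)\<close>: the
      contraction and the error of that iterate contribute half of the bound each.\<close>
    have "\<bar>u t x - u0 x - integral {0..t} (\<lambda>s. V (u s) x)\<bar> \<le> 2 * (K * exp (2 * \<Lambda> * t)) / 2 ^ n" for n
    proof -
      have "\<bar>integral {0..t} (\<lambda>s. V (u s) x) - integral {0..t} (\<lambda>s. V (picard u0 n s) x)\<bar> \<le>
          2 * K / 2 ^ n / 2 * exp (2 * \<Lambda> * t)"
      proof (rule picard_contraction[OF cont continuous_on_picard _ x t])
        show "\<bar>u s z - picard u0 n s z\<bar> \<le> 2 * K / 2 ^ n * exp (2 * \<Lambda> * s)" if "0 \<le> s" "z \<in> P" for s z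
          using u[OF that, of n] by (simp add: mult.assoc)
      qed (use K0 in auto)
      moreover have "\<bar>u t x - picard u0 (Suc n) t x\<bar> \<le> 2 * (K * exp (2 * \<Lambda> * t)) / 2 ^ Suc n"
        by (rule u[OF t x])
      ultimately show ?thesis by (simp add: field_simps abs_le_iff)
    qed
    then have "u t x - u0 x - integral {0..t} (\<lambda>s. V (u s) x) = 0"
      by (rule le_geometric_imp_zero)
    then show ?thesis by simp
  qed
  then show ?thesis using cont unfolding solves_def by blast
qed

end

section \<open>Finite mixtures of Diracs and functional gradients\<close>

text \<open>\<open>measure_of\<close> returns the prescribed values only for a countably additive
  set function, which is what has to be checked.\<close>

lemma
  fixes M N :: "'a measure"
  assumes sets: "sets N = sets M" and space: "space N = space M"
  shows sets_half_mixture: "sets (half_mixture M N) = sets M"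
    and space_half_mixture: "space (half_mixture M N) = space M"
    and emeasure_half_mixture: "A \<in> sets M \<Longrightarrow>
      emeasure (half_mixture M N) A = ennreal (1/2) * emeasure M A + ennreal (1/2) * emeasure N A"
proof -
  show 1: "sets (half_mixture M N) = sets M"
    by (simp add: half_mixture_def sets.space_closed sets.sigma_sets_eq)
  show "space (half_mixture M N) = space M"
    by (simp add: half_mixture_def sets.space_closed)
  show "emeasure (half_mixture M N) A = ennreal (1/2) * emeasure M A + ennreal (1/2) * emeasure N A"
    if "A \<in> sets M"
  proof (rule emeasure_measure_of[OF half_mixture_def])
    let ?\<mu> = "\<lambda>A. ennreal (1/2) * emeasure M A + ennreal (1/2) * emeasure N A"
    show "sets M \<subseteq> Pow (space M)" by (rule sets.space_closed)
    show "A \<in> sets (half_mixture M N)" using that 1 by simp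
    show "positive (sets (half_mixture M N)) ?\<mu>" by (simp add: positive_def)
    show "countably_additive (sets (half_mixture M N)) ?\<mu>"
    proof (rule countably_additiveI)
      fix X :: "nat \<Rightarrow> 'a set"
      assume X: "range X \<subseteq> sets (half_mixture M N)" "disjoint_family X"
      then have "range X \<subseteq> sets M" "range X \<subseteq> sets N" using 1 sets by auto
      then show "(\<Sum>i. ?\<mu> (X i)) = ?\<mu> (\<Union>(range X))"
        using X(2) by (simp add: suminf_add[symmetric] suminf_emeasure)
    qed
  qed
qed

text \<open>On \<open>P\<close> the integrand is a finite sum of multiples of indicators of
  measurable singletons, so \<open>g\<close> may be an arbitrary function.\<close>

lemma set_integral_finite_set:
  fixes g :: "'a \<Rightarrow> real"
  assumes "finite P" and meas: "\<And>x. x \<in> P \<Longrightarrow> {x} \<in> sets M" and "finite_measure M"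
  shows "(LINT x:P|M. g x) = (\<Sum>x\<in>P. measure M {x} * g x)"
proof -
  interpret finite_measure M by fact
  have "(LINT x:P|M. g x) = (LINT x|M. (\<Sum>p\<in>P. indicator {p} x * g p))"
    unfolding set_lebesgue_integral_def
    using \<open>finite P\<close> by (intro Bochner_Integration.integral_cong) (auto simp: indicator_def if_distrib if_distribR cong: if_cong)
  also have "\<dots> = (\<Sum>x\<in>P. measure M {x} * g x)"
    using meas emeasure_finite
    by (subst Bochner_Integration.integral_sum) (auto intro!: sum.cong integrable_mult_left integrable_real_indicator simp: less_top[symmetric])
  finally show ?thesis .
qed

lemma finite_dirac_mixture_support:
  fixes M :: "'a::t1_space measure"
  assumes "finite_dirac_mixture M" and open_meas: "\<And>U. open U \<Longrightarrow> U \<inter> space M \<in> sets M"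
  shows "finite (msupp M)" and "x \<in> msupp M \<Longrightarrow> 0 < emeasure M {x}"
proof -
  obtain S w where S: "finite S" "S \<subseteq> space M"
    and eq: "\<And>A. A \<in> sets M \<Longrightarrow> emeasure M A = (\<Sum>x\<in>S. ennreal (w x) * emeasure (return M x) A)"
    using assms(1) unfolding finite_dirac_mixture_def by blast
  have *: "x \<in> S \<and> 0 < emeasure M {x}" if x: "x \<in> msupp M" for x
  proof -
    \<comment> \<open>An open neighbourhood of \<open>x\<close> that contains no other atom, so its
      mass is that of \<open>{x}\<close>.\<close>
    define U where "U = - (S - {x})"
    have U: "open U" "x \<in> U"
      unfolding U_def using S(1) by (intro open_Compl finite_imp_closed, auto)
    have xs: "x \<in> space M" using x by (simp add: msupp_def)
    have pos: "0 < emeasure M (U \<inter> space M)" using x U by (simp add: msupp_def)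
    have "space M - (space M \<inter> (- {x})) \<in> sets M"
      using open_meas[of "- {x}"] by (auto simp: Int_commute)
    then have x_meas: "{x} \<in> sets M"
      using xs by (simp add: Diff_Int Diff_Compl)
    have "emeasure M (U \<inter> space M) = emeasure M {x}"
      unfolding eq[OF open_meas[OF U(1)]] eq[OF x_meas]
      using open_meas[OF U(1)] x_meas S(2) xs
      by (intro sum.cong refl arg_cong[where f = "\<lambda>r. _ * r"]) (auto simp: U_def indicator_def)
    moreover have "x \<in> S"
    proof (rule ccontr)
      assume "x \<notin> S"
      then have "emeasure M {x} = 0"
        unfolding eq[OF x_meas] using x_meas by (intro sum.neutral) (auto simp: indicator_def)
      then show False using pos \<open>emeasure M (U \<inter> space M) = emeasure M {x}\<close> by simp
    qed
    ultimately show ?thesis using pos by simp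
  qed
  then show "finite (msupp M)" using S(1) by (auto intro: finite_subset)
  show "x \<in> msupp M \<Longrightarrow> 0 < emeasure M {x}" using * by blast
qed

text \<open>A point of \<open>P\<close> outside the support has a null neighbourhood and contributes
  nothing. This lets integrals against different measures be written over one common finite
  set.\<close>

lemma set_integral_msupp:
  fixes g :: "'a::topological_space \<Rightarrow> real"
  assumes "finite P" and P: "msupp M \<subseteq> P" "P \<subseteq> space M" and "finite_measure M"
    and single: "\<And>x. x \<in> P \<Longrightarrow> {x} \<in> sets M" and open_meas: "\<And>U. open U \<Longrightarrow> U \<inter> space M \<in> sets M"
  shows "(LINT x:msupp M|M. g x) = (\<Sum>x\<in>P. measure M {x} * g x)"
proof -
  have "(LINT x:msupp M|M. g x) = (\<Sum>x\<in>msupp M. measure M {x} * g x)"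
    using assms by (intro set_integral_finite_set) (auto intro: finite_subset)
  also have "\<dots> = (\<Sum>x\<in>P. measure M {x} * g x)"
  proof (rule sum.mono_neutral_left[OF \<open>finite P\<close> P(1)], rule ballI)
    fix x assume x: "x \<in> P - msupp M"
    then obtain U where U: "open U" "x \<in> U" "emeasure M (U \<inter> space M) = 0"
      using P(2) by (auto simp: msupp_def)
    have "emeasure M {x} \<le> emeasure M (U \<inter> space M)"
      using U x P(2) open_meas by (intro emeasure_mono) auto
    then show "measure M {x} * g x = 0" using U(3) by (simp add: measure_def)
  qed
  finally show ?thesis .
qed

text \<open>The directional derivative of a sum of pointwise losses is the sum of
  \<open>l' x (f x) * \<psi> x\<close>; the inner product weights \<open>x\<close> by
  \<open>G x\<close>, hence the division. Testing against the indicator of a single point gives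
  uniqueness.\<close>

lemma functional_gradient_eqI:
  fixes M :: "'a::topological_space measure"
  assumes fin: "finite (msupp M)" and G: "\<And>x. x \<in> msupp M \<Longrightarrow> 0 < G x"
    and inner: "\<And>g h. L2_inner M g h = (\<Sum>x\<in>msupp M. G x * (g x * h x))"
    and L: "\<And>f. L f = (\<Sum>x\<in>msupp M. l x (f x))"
    and deriv: "\<And>x r. x \<in> msupp M \<Longrightarrow> (l x has_real_derivative l' x r) (at r)"
  shows "functional_gradient M L f = (\<lambda>x\<in>msupp M. l' x (f x) / G x)"
  unfolding functional_gradient_def
proof (rule the_equality)
  let ?P = "msupp M" and ?f = "restrict f (msupp M)"
  define D where "D \<psi> = (\<Sum>x\<in>?P. l' x (f x) * \<psi> x)" for \<psi>
  have lim: "((\<lambda>\<epsilon>. 1 / \<epsilon> * (L (\<lambda>x\<in>?P. ?f x + \<epsilon> * \<psi> x) - L ?f)) \<longlongrightarrow> D \<psi>) (at 0)" for \<psi>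
  proof -
    have "((\<lambda>\<epsilon>. l x (f x + \<epsilon> * \<psi> x)) has_real_derivative l' x (f x) * \<psi> x) (at 0)" if "x \<in> ?P" for x
      by (rule DERIV_chain'[where f = "\<lambda>\<epsilon>. f x + \<epsilon> * \<psi> x" and g = "l x"])
         (use deriv[OF that, of "f x"] in \<open>auto intro!: derivative_eq_intros\<close>)
    then have "((\<lambda>\<epsilon>. \<Sum>x\<in>?P. l x (f x + \<epsilon> * \<psi> x)) has_real_derivative D \<psi>) (at 0)"
      unfolding D_def by (rule DERIV_sum)
    then show ?thesis
      unfolding DERIV_def by (simp add: L)
  qed
  have D_eq: "L2_inner M (\<lambda>x\<in>?P. l' x (f x) / G x) \<psi> = D \<psi>" for \<psi>
    unfolding inner D_def using G by (intro sum.cong) (auto simp: less_imp_neq[symmetric] field_simps)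
  show "is_functional_gradient M L ?f (\<lambda>x\<in>?P. l' x (f x) / G x)"
    unfolding is_functional_gradient_def D_eq using lim by (auto simp: L2_supp_def)
  fix g assume g: "is_functional_gradient M L ?f g"
  show "g = (\<lambda>x\<in>?P. l' x (f x) / G x)"
  proof (rule extensionalityI[where A = ?P])
    show "g \<in> extensional ?P" using g by (simp add: is_functional_gradient_def L2_supp_def)
    fix x assume x: "x \<in> ?P"
    define \<psi> where "\<psi> = (\<lambda>y\<in>?P. if y = x then 1 else 0 :: real)"
    have "\<psi> \<in> L2_supp M" by (simp add: L2_supp_def \<psi>_def)
    then have "((\<lambda>\<epsilon>. 1 / \<epsilon> * (L (\<lambda>x\<in>?P. ?f x + \<epsilon> * \<psi> x) - L ?f)) \<longlongrightarrow> L2_inner M g \<psi>) (at 0)"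
      using g unfolding is_functional_gradient_def by blast
    then have "L2_inner M g \<psi> = D \<psi>"
      using lim by (rule LIM_unique)
    moreover have "L2_inner M g \<psi> = (\<Sum>y\<in>?P. if y = x then G x * g x else 0)"
      unfolding inner by (intro sum.cong) (auto simp: \<psi>_def)
    moreover have "D \<psi> = (\<Sum>y\<in>?P. if y = x then l' x (f x) else 0)"
      unfolding D_def by (intro sum.cong) (auto simp: \<psi>_def)
    ultimately have "G x * g x = l' x (f x)" using x fin by simp
    then show "g x = (\<lambda>x\<in>?P. l' x (f x) / G x) x"
      using x G[OF x] by (auto simp: field_simps)
  qed simp
qed

section \<open>The gradient flow\<close>

text \<open>The velocity at any point of \<open>A\<close> depends only on the values on the support,
  so these form a closed finite system. Once it is solved, the values elsewhere follow by
  integration in time.\<close>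

lemma gradient_flow_wellposed:
  fixes k :: "'a::euclidean_space \<times> 'a \<Rightarrow> real" and \<psi> :: "'a \<Rightarrow> real \<Rightarrow> real"
  assumes fin: "finite (msupp M)" and sub: "msupp M \<subseteq> A"
    and kop: "\<And>h y. kernel_op k M h y = (\<Sum>z\<in>msupp M. w z * (k (y, z) * h z))"
    and grad: "\<And>f z. z \<in> msupp M \<Longrightarrow> functional_gradient M L f z = \<psi> z (f z)"
    and lip: "\<And>z. z \<in> msupp M \<Longrightarrow> \<exists>C. C-lipschitz_on UNIV (\<psi> z)"
    and sect: "\<And>z. z \<in> msupp M \<Longrightarrow> (\<lambda>y. k (y, z)) \<in> borel_measurable (lebesgue_on A)"
      "\<And>z. z \<in> msupp M \<Longrightarrow> integrable (lebesgue_on A) (\<lambda>y. (k (y, z))\<^sup>2)"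
    and f0: "f0 \<in> L2_fun A"
  shows "\<exists>!f. gradient_flow_solution A k M L f0 f"
    and "gradient_flow_solution A k M L f0 f \<Longrightarrow> 0 \<le> t \<Longrightarrow> x \<in> A \<Longrightarrow>
      ((\<lambda>s. kernel_op k M (functional_gradient M L (f s)) x) has_integral f t x - f0 x) {0..t}"
    and "gradient_flow_solution A k M L f0 f \<Longrightarrow> 0 \<le> t \<Longrightarrow> z \<in> msupp M \<Longrightarrow>
      (\<lambda>s. functional_gradient M L (f s) z) integrable_on {0..t}"
    and "gradient_flow_solution A k M L f0 f \<Longrightarrow> 0 \<le> t \<Longrightarrow> x \<in> A \<Longrightarrow>
      f t x = f0 x + kernel_op k M (\<lambda>y\<in>msupp M. integral {0..t} (\<lambda>s. functional_gradient M L (f s) y)) x"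
proof -
  let ?P = "msupp M"
  define V where "V u x = kernel_op k M (functional_gradient M L u) x" for u x
  have V: "V u x = (\<Sum>z\<in>?P. w z * (k (x, z) * \<psi> z (u z)))" for u x
    unfolding V_def kop by (intro sum.cong refl) (simp add: grad)
  obtain C where C: "\<And>z. z \<in> ?P \<Longrightarrow> (C z)-lipschitz_on UNIV (\<psi> z)"
    using lip by metis
  have C_le: "\<bar>\<psi> z r - \<psi> z s\<bar> \<le> C z * \<bar>r - s\<bar>" and C0: "0 \<le> C z" if "z \<in> ?P" for z r s
    using lipschitz_onD[OF C[OF that], of r s] lipschitz_on_nonneg[OF C[OF that]] by (auto simp: dist_real_def)
  have \<psi>_cont: "continuous_on S (\<lambda>s. \<psi> z (u s))" if "z \<in> ?P" "continuous_on S u" for z S and u :: "real \<Rightarrow> real"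
    using continuous_on_compose2[OF lipschitz_on_continuous_on[OF C[OF that(1)]] that(2)] by simp
  \<comment> \<open>The double sum dominates the Lipschitz constant of every coordinate; the 1 keeps
    \<Lambda> positive when the sum vanishes.\<close>
  define \<Lambda> where "\<Lambda> = 1 + (\<Sum>x\<in>?P. \<Sum>z\<in>?P. \<bar>w z * k (x, z)\<bar> * C z)"
  have inner_nonneg: "0 \<le> (\<Sum>z\<in>?P. \<bar>w z * k (x, z)\<bar> * C z)" for x
    using C0 by (intro sum_nonneg) auto
  interpret finite_lipschitz_field ?P V \<Lambda>
  proof
    show "0 < \<Lambda>" unfolding \<Lambda>_def by (intro add_pos_nonneg sum_nonneg inner_nonneg) auto
    fix x and u v :: "'a \<Rightarrow> real" and B
    assume x: "x \<in> ?P" and uv: "\<And>z. z \<in> ?P \<Longrightarrow> \<bar>u z - v z\<bar> \<le> B"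
    have B: "0 \<le> B" using uv[OF x] by simp
    have "\<bar>V u x - V v x\<bar> = \<bar>\<Sum>z\<in>?P. w z * k (x, z) * (\<psi> z (u z) - \<psi> z (v z))\<bar>"
      by (simp add: V sum_subtractf[symmetric] algebra_simps)
    also have "\<dots> \<le> (\<Sum>z\<in>?P. \<bar>w z * k (x, z)\<bar> * C z * B)"
    proof (rule order_trans[OF sum_abs], rule sum_mono)
      fix z assume z: "z \<in> ?P"
      have "\<bar>\<psi> z (u z) - \<psi> z (v z)\<bar> \<le> C z * B"
        using C_le[OF z, of "u z" "v z"] mult_left_mono[OF uv[OF z] C0[OF z]] by linarith
      then show "\<bar>w z * k (x, z) * (\<psi> z (u z) - \<psi> z (v z))\<bar> \<le> \<bar>w z * k (x, z)\<bar> * C z * B"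
        by (simp add: abs_mult mult.assoc mult_left_mono)
    qed
    also have "\<dots> = (\<Sum>z\<in>?P. \<bar>w z * k (x, z)\<bar> * C z) * B"
      by (simp add: sum_distrib_right)
    also have "\<dots> \<le> \<Lambda> * B"
    proof (rule mult_right_mono[OF _ B])
      have "(\<Sum>z\<in>?P. \<bar>w z * k (x, z)\<bar> * C z) \<le> (\<Sum>x\<in>?P. \<Sum>z\<in>?P. \<bar>w z * k (x, z)\<bar> * C z)"
        by (rule member_le_sum[OF x _ fin]) (rule inner_nonneg)
      then show "(\<Sum>z\<in>?P. \<bar>w z * k (x, z)\<bar> * C z) \<le> \<Lambda>" by (simp add: \<Lambda>_def)
    qed
    finally show "\<bar>V u x - V v x\<bar> \<le> \<Lambda> * B" .
  qed (rule fin)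

  have V_cong: "V u x = V v x" if "\<And>z. z \<in> ?P \<Longrightarrow> u z = v z" for u v x
    unfolding V using that by (intro sum.cong) auto
  have V_integral: "((\<lambda>s. V (u s) x) has_integral
      (\<Sum>z\<in>?P. w z * (k (x, z) * integral {0..t} (\<lambda>s. \<psi> z (u s z))))) {0..t}"
    if cont: "\<And>z. z \<in> ?P \<Longrightarrow> continuous_on {0..t} (\<lambda>s. u s z)" for u x and t :: real
  proof -
    have "(\<lambda>s. \<psi> z (u s z)) integrable_on {0..t}" if "z \<in> ?P" for z
      by (rule integrable_continuous_real, rule \<psi>_cont[OF that cont[OF that]])
    then show ?thesis
      unfolding V by (intro has_integral_sum fin has_integral_mult_right integrable_integral)
  qed

  have cont: "continuous_on {0..t} (\<lambda>s. f s x)" if "gradient_flow_solution A k M L f0 f" "x \<in> A" for f t x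
    using that unfolding gradient_flow_solution_def continuous_on_eq_continuous_within
    by (meson DERIV_continuous DERIV_subset atLeastAtMost_iff atLeast_iff subsetI)
  have ftc: "((\<lambda>s. V (f s) x) has_integral f t x - f0 x) {0..t}"
    if sol: "gradient_flow_solution A k M L f0 f" and "0 \<le> t" "x \<in> A" for f t x
  proof -
    have "((\<lambda>s. V (f s) x) has_integral f t x - f 0 x) {0..t}"
    proof (rule fundamental_theorem_of_calculus[OF \<open>0 \<le> t\<close>])
      fix s assume s: "s \<in> {0..t}"
      then have "((\<lambda>s. f s x) has_real_derivative V (f s) x) (at s within {0..})"
        using sol \<open>x \<in> A\<close> by (auto simp: gradient_flow_solution_def V_def)
      then show "((\<lambda>s. f s x) has_vector_derivative V (f s) x) (at s within {0..t})"
        unfolding has_real_derivative_iff_has_vector_derivative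
        by (rule has_vector_derivative_within_subset) auto
    qed
    then show ?thesis using sol by (simp add: gradient_flow_solution_def)
  qed
  then show "gradient_flow_solution A k M L f0 f \<Longrightarrow> 0 \<le> t \<Longrightarrow> x \<in> A \<Longrightarrow>
      ((\<lambda>s. kernel_op k M (functional_gradient M L (f s)) x) has_integral f t x - f0 x) {0..t}"
    by (simp add: V_def)
  show "(\<lambda>s. functional_gradient M L (f s) z) integrable_on {0..t}"
    if "gradient_flow_solution A k M L f0 f" "0 \<le> t" "z \<in> ?P"
    unfolding grad[OF that(3)]
    by (rule integrable_continuous_real, rule \<psi>_cont[OF that(3) cont[OF that(1)]]) (use that(3) sub in auto)
  show "f t x = f0 x + kernel_op k M (\<lambda>y\<in>?P. integral {0..t} (\<lambda>s. functional_gradient M L (f s) y)) x"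
    if sol: "gradient_flow_solution A k M L f0 f" and "0 \<le> t" "x \<in> A"
  proof -
    have "kernel_op k M (\<lambda>y\<in>?P. integral {0..t} (\<lambda>s. functional_gradient M L (f s) y)) x =
        (\<Sum>z\<in>?P. w z * (k (x, z) * integral {0..t} (\<lambda>s. \<psi> z (f s z))))"
      unfolding kop by (intro sum.cong refl) (simp add: grad)
    also have "\<dots> = f t x - f0 x"
      using sub by (intro has_integral_unique[OF V_integral ftc[OF that]] cont[OF sol]) auto
    finally show ?thesis by simp
  qed

  have solves: "solves f0 f" if "gradient_flow_solution A k M L f0 f" for f
    unfolding solves_def
  proof (intro ballI allI impI conjI)
    fix x and t :: real assume "x \<in> ?P" "0 \<le> t"
    then have "x \<in> A" using sub by auto
    then show "continuous_on {0..t} (\<lambda>s. f s x)" by (rule cont[OF that])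
    show "f t x = f0 x + integral {0..t} (\<lambda>s. V (f s) x)"
      using ftc[OF that \<open>0 \<le> t\<close> \<open>x \<in> A\<close>] by (simp add: integral_unique)
  qed
  have unique: "f = g"
    if f: "gradient_flow_solution A k M L f0 f" and g: "gradient_flow_solution A k M L f0 g" for f g
  proof -
    \<comment> \<open>Uniqueness of the finite system gives agreement on the support. Then the
      velocities coincide at every \<open>x\<close> in \<open>A\<close>, and so do their
      integrals.\<close>
    have eq: "f t x = g t x" if "0 \<le> t" "x \<in> A" for t x
    proof -
      have "V (f s) x = V (g s) x" if "s \<in> {0..t}" for s
        using that by (intro V_cong solves_unique[OF solves[OF f] solves[OF g]]) auto
      then have "((\<lambda>s. V (g s) x) has_integral f t x - f0 x) {0..t}"
        using has_integral_cong[of "{0..t}" "\<lambda>s. V (f s) x" "\<lambda>s. V (g s) x"] ftc[OF f that] by simp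
      then show ?thesis
        using has_integral_unique[OF _ ftc[OF g that]] by fastforce
    qed
    have mem: "f \<in> {0..} \<rightarrow>\<^sub>E L2_fun A" "g \<in> {0..} \<rightarrow>\<^sub>E L2_fun A"
      using f g by (auto simp: gradient_flow_solution_def)
    show "f = g"
    proof (rule PiE_ext[OF mem])
      fix t :: real assume "t \<in> {0..}"
      then have "f t \<in> extensional A" "g t \<in> extensional A"
        using mem by (auto simp: PiE_iff L2_fun_def)
      then show "f t = g t"
        using eq \<open>t \<in> {0..}\<close> by (intro extensionalityI) auto
    qed
  qed

  obtain u where "solves f0 u" using exists_solution by blast
  then have u_cont: "\<And>z t. z \<in> ?P \<Longrightarrow> 0 \<le> t \<Longrightarrow> continuous_on {0..t} (\<lambda>s. u s z)"
    and u_eq: "\<And>z t. z \<in> ?P \<Longrightarrow> 0 \<le> t \<Longrightarrow> u t z = f0 z + integral {0..t} (\<lambda>s. V (u s) z)"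
    by (auto simp: solves_def)
  define c where "c z t = integral {0..t} (\<lambda>s. \<psi> z (u s z))" for z t
  have c_deriv: "(c z has_real_derivative \<psi> z (u t z)) (at t within {0..})" if z: "z \<in> ?P" and t: "0 \<le> t" for z t
  proof -
    \<comment> \<open>Going beyond \<open>t\<close> by one unit makes the interval a neighbourhood
      of \<open>t\<close> within the half-line, so the derivative there is the one required.\<close>
    have "(c z has_real_derivative \<psi> z (u t z)) (at t within {0..t + 1})"
      unfolding c_def[abs_def]
      by (rule integral_has_real_derivative) (use z t in \<open>auto intro!: \<psi>_cont u_cont\<close>)
    moreover have "at t within {0..t + 1} = at t within {0..}"
      by (rule at_within_nhd[of t "{..<t + 1}"]) auto
    ultimately show ?thesis by simp
  qed
  \<comment> \<open>\<open>c z t\<close> is the gradient at \<open>z\<close> accumulated up to time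
    \<open>t\<close>. On the support \<open>f\<close> reproduces \<open>u\<close>, so the velocity
    computed from \<open>u\<close> is also the one computed from \<open>f\<close>.\<close>
  define f where "f = (\<lambda>t\<in>{0..}. \<lambda>x\<in>A. f0 x + (\<Sum>z\<in>?P. k (x, z) * (w z * c z t)))"
  have f_P: "f t z = u t z" if "z \<in> ?P" "0 \<le> t" for t z
    using that sub u_eq[OF that] integral_unique[OF V_integral[of t u z]] u_cont
    by (auto simp: f_def c_def mult_ac)
  have "gradient_flow_solution A k M L f0 f"
    unfolding gradient_flow_solution_def
  proof (intro conjI allI impI ballI)
    show "f \<in> {0..} \<rightarrow>\<^sub>E L2_fun A"
    proof (rule PiE_I)
      fix t :: real assume t: "t \<in> {0..}"
      have "(\<lambda>x. f0 x + (\<Sum>z\<in>?P. k (x, z) * (w z * c z t))) \<in> borel_measurable (lebesgue_on A) \<and>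
          integrable (lebesgue_on A) (\<lambda>x. (f0 x + (\<Sum>z\<in>?P. k (x, z) * (w z * c z t)))\<^sup>2)"
        using f0 sect by (intro square_integrable_add_sum fin) (auto simp: L2_fun_def)
      moreover have eq: "f t x = f0 x + (\<Sum>z\<in>?P. k (x, z) * (w z * c z t))" if "x \<in> A" for x
        using that t by (simp add: f_def)
      have "f t \<in> borel_measurable (lebesgue_on A) \<longleftrightarrow>
          (\<lambda>x. f0 x + (\<Sum>z\<in>?P. k (x, z) * (w z * c z t))) \<in> borel_measurable (lebesgue_on A)"
        by (rule measurable_cong) (simp add: eq)
      moreover have "integrable (lebesgue_on A) (\<lambda>x. (f t x)\<^sup>2) \<longleftrightarrow>
          integrable (lebesgue_on A) (\<lambda>x. (f0 x + (\<Sum>z\<in>?P. k (x, z) * (w z * c z t)))\<^sup>2)"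
        by (rule Bochner_Integration.integrable_cong) (simp_all add: eq)
      moreover have "f t \<in> extensional A" using t by (simp add: f_def)
      ultimately show "f t \<in> L2_fun A"
        by (simp add: L2_fun_def)
    qed (simp add: f_def)
    show "f 0 = f0"
      using f0 by (auto simp: f_def c_def fun_eq_iff L2_fun_def extensional_def)
    fix t :: real and x assume t: "0 \<le> t" and x: "x \<in> A"
    have "((\<lambda>s. f0 x + (\<Sum>z\<in>?P. k (x, z) * (w z * c z s))) has_real_derivative V (u t) x) (at t within {0..})"
      unfolding V using t by (auto intro!: derivative_eq_intros c_deriv sum.cong simp: mult_ac)
    then have "((\<lambda>s. f s x) has_real_derivative V (u t) x) (at t within {0..})"
      by (rule has_field_derivative_transform_within[OF _ zero_less_one]) (use t x in \<open>auto simp: f_def\<close>)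
    moreover have "V (u t) x = V (f t) x"
      using f_P t by (intro V_cong) auto
    ultimately show "((\<lambda>s. f s x) has_real_derivative kernel_op k M (functional_gradient M L (f t)) x)
        (at t within {0..})"
      by (simp add: V_def)
  qed
  then show "\<exists>!f. gradient_flow_solution A k M L f0 f"
    using unique by blast
qed

lemma lipschitz_on_linear_combination:
  fixes f g :: "real \<Rightarrow> real"
  assumes "C-lipschitz_on UNIV f" "D-lipschitz_on UNIV g"
  shows "(\<bar>r\<bar> * C + \<bar>s\<bar> * D)-lipschitz_on UNIV (\<lambda>x. r * f x - s * g x)"
  using lipschitz_on_diff[OF lipschitz_on_cmult[OF assms(1), of r] lipschitz_on_cmult[OF assms(2), of s]]
  by simp

theorem theorem1:
  fixes \<Omega> :: "(real ^ 'n) set"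
    and \<alpha> \<beta> \<gamma> :: "(real ^ 'n) measure"
    and k :: "(real ^ 'n) \<times> (real ^ 'n) \<Rightarrow> real"
    and a b :: "real \<Rightarrow> real"
    and L :: "((real ^ 'n) \<Rightarrow> real) \<Rightarrow> real"
    and f0 :: "(real ^ 'n) \<Rightarrow> real"
  assumes "closed \<Omega>" and "convex \<Omega>"
    and "prob_dist_on \<Omega> \<alpha>" and "prob_dist_on \<Omega> \<beta>"
    and "\<gamma> = half_mixture \<alpha> \<beta>" and "finite_dirac_mixture \<gamma>"
    and "sym_kernel_on \<Omega> k" and "psd_kernel_on \<Omega> k" and "k \<in> L2_fun (\<Omega> \<times> \<Omega>)"
    and "a differentiable_on UNIV" and "\<exists>C. C-lipschitz_on UNIV (deriv a)"
    and "b differentiable_on UNIV" and "\<exists>C. C-lipschitz_on UNIV (deriv b)"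
    and "L = disc_loss a b \<alpha> \<beta>"
    and "f0 \<in> L2_fun \<Omega>"
  shows "(\<exists>!f. gradient_flow_solution \<Omega> k \<gamma> L f0 f) \<and>
    (\<forall>f. gradient_flow_solution \<Omega> k \<gamma> L f0 f \<longrightarrow>
      (\<forall>t\<ge>0.
        (\<forall>x\<in>\<Omega>. (\<lambda>s. kernel_op k \<gamma> (functional_gradient \<gamma> L (f s)) x) integrable_on {0..t}) \<and>
        (\<forall>x\<in>msupp \<gamma>. (\<lambda>s. functional_gradient \<gamma> L (f s) x) integrable_on {0..t}) \<and>
        (\<forall>x\<in>\<Omega>.
          f t x = f0 x + integral {0..t} (\<lambda>s. kernel_op k \<gamma> (functional_gradient \<gamma> L (f s)) x) \<and>
          f t x = f0 x + kernel_op k \<gamma>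
            (\<lambda>y\<in>msupp \<gamma>. integral {0..t} (\<lambda>s. functional_gradient \<gamma> L (f s) y)) x)))"
proof -
  let ?P = "msupp \<gamma>"
  define A where "A x = measure \<alpha> {x}" for x
  define B where "B x = measure \<beta> {x}" for x
  define G where "G x = measure \<gamma> {x}" for x
  \<comment> \<open>\<open>l x\<close> collects the contribution of the value at \<open>x\<close> to
    the loss, and \<psi> below is its derivative relative to the mass of \<gamma> at
    \<open>x\<close>.\<close>
  define l where "l x r = A x * a r - B x * b r" for x r
  define l' where "l' x r = A x * deriv a r - B x * deriv b r" for x r
  define \<psi> where "\<psi> x r = l' x r / G x" for x r

  have "prob_space \<alpha>" "prob_space \<beta>" and space: "space \<alpha> = \<Omega>" "space \<beta> = \<Omega>"
    and sets: "sets \<alpha> = sets (restrict_space borel \<Omega>)" "sets \<beta> = sets (restrict_space borel \<Omega>)"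
    using assms(3,4) by (auto simp: prob_dist_on_def)
  interpret \<alpha>: prob_space \<alpha> by fact
  interpret \<beta>: prob_space \<beta> by fact
  have same: "sets \<beta> = sets \<alpha>" "space \<beta> = space \<alpha>" using sets space by auto
  have sets_\<gamma>: "sets \<gamma> = sets \<alpha>" and space_\<gamma>: "space \<gamma> = \<Omega>"
    and em_\<gamma>: "X \<in> sets \<alpha> \<Longrightarrow> emeasure \<gamma> X = ennreal (1/2) * emeasure \<alpha> X + ennreal (1/2) * emeasure \<beta> X" for X
    unfolding assms(5) using same space
    by (auto simp: sets_half_mixture space_half_mixture emeasure_half_mixture)
  have open_meas: "U \<inter> \<Omega> \<in> sets \<alpha>" if "open U" for U
    using that unfolding sets(1) sets_restrict_space by (auto simp: Int_commute)
  have single: "{x} \<in> sets \<alpha>" if "x \<in> \<Omega>" for x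
    using that unfolding sets(1) sets_restrict_space by (auto intro!: image_eqI[of _ _ "{x}"])
  have \<Omega>_meas: "\<Omega> \<in> sets \<alpha>" using sets.top[of \<alpha>] space by simp
  have "emeasure \<gamma> \<Omega> \<noteq> \<infinity>"
    using em_\<gamma>[OF \<Omega>_meas] \<alpha>.emeasure_finite \<beta>.emeasure_finite by (simp add: ennreal_mult_eq_top_iff)
  then have fin_\<gamma>: "finite_measure \<gamma>" by (intro finite_measureI) (simp add: space_\<gamma>)
  then interpret \<gamma>: finite_measure \<gamma> .

  have fin: "finite ?P"
    using assms(6) open_meas by (intro finite_dirac_mixture_support(1)) (simp_all add: sets_\<gamma> space_\<gamma>)
  have sub: "?P \<subseteq> \<Omega>" by (auto simp: msupp_def space_\<gamma>)
  have G: "0 < G x" if "x \<in> ?P" for x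
  proof -
    have "0 < emeasure \<gamma> {x}"
      using assms(6) open_meas that by (intro finite_dirac_mixture_support(2)) (simp_all add: sets_\<gamma> space_\<gamma>)
    then show ?thesis by (simp add: G_def \<gamma>.emeasure_eq_measure)
  qed
  \<comment> \<open>An open set that is null for the half mixture is null for both
    components.\<close>
  have msupp_sub: "msupp \<alpha> \<subseteq> ?P" "msupp \<beta> \<subseteq> ?P"
    using em_\<gamma>[OF open_meas] by (auto simp: msupp_def space space_\<gamma> zero_less_iff_neq_zero)

  have int_\<alpha>: "(LINT x:msupp \<alpha>|\<alpha>. g x) = (\<Sum>x\<in>?P. A x * g x)" for g :: "real ^ 'n \<Rightarrow> real"
    unfolding A_def using fin msupp_sub(1) sub open_meas single \<alpha>.finite_measure_axioms
    by (intro set_integral_msupp) (auto simp: space)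
  have int_\<beta>: "(LINT x:msupp \<beta>|\<beta>. g x) = (\<Sum>x\<in>?P. B x * g x)" for g :: "real ^ 'n \<Rightarrow> real"
    unfolding B_def using fin msupp_sub(2) sub open_meas single \<beta>.finite_measure_axioms
    by (intro set_integral_msupp) (auto simp: space same(1))
  have int_\<gamma>: "(LINT x:?P|\<gamma>. g x) = (\<Sum>x\<in>?P. G x * g x)" for g :: "real ^ 'n \<Rightarrow> real"
    unfolding G_def using fin sub single fin_\<gamma> by (intro set_integral_finite_set) (auto simp: sets_\<gamma>)

  have grad: "functional_gradient \<gamma> L f = (\<lambda>x\<in>?P. l' x (f x) / G x)" for f
  proof (rule functional_gradient_eqI[OF fin G])
    show "L2_inner \<gamma> g h = (\<Sum>x\<in>?P. G x * (g x * h x))" for g h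
      unfolding L2_inner_def by (rule int_\<gamma>)
    show "L f = (\<Sum>x\<in>?P. l x (f x))" for f
      unfolding assms(14) disc_loss_def int_\<alpha> int_\<beta> by (simp add: l_def sum_subtractf)
    have "(a has_real_derivative deriv a r) (at r)" "(b has_real_derivative deriv b r) (at r)" for r
      using assms(10,12) by (auto simp: DERIV_deriv_iff_real_differentiable differentiable_on_def)
    then show "(l x has_real_derivative l' x r) (at r)" for x r
      unfolding l_def[abs_def] l'_def by (intro DERIV_diff DERIV_cmult)
  qed
  have grad_P: "functional_gradient \<gamma> L f z = \<psi> z (f z)" if "z \<in> ?P" for f z
    using that by (simp add: grad \<psi>_def)
  have lip: "\<exists>C. C-lipschitz_on UNIV (\<psi> z)" for z
  proof -
    obtain C D where "C-lipschitz_on UNIV (deriv a)" "D-lipschitz_on UNIV (deriv b)"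
      using assms(11,13) by auto
    from lipschitz_on_linear_combination[OF this, of "A z / G z" "B z / G z"]
    show ?thesis by (auto simp: \<psi>_def[abs_def] l'_def diff_divide_distrib)
  qed

  have \<Omega>: "\<Omega> \<in> sets lebesgue" "\<Omega> \<times> \<Omega> \<in> sets lebesgue"
    using closed_Times[OF assms(1) assms(1)] assms(1) by (auto intro: sets_completionI_sets)
  have sect: "(\<lambda>y. k (y, z)) \<in> borel_measurable (lebesgue_on \<Omega>)"
    "integrable (lebesgue_on \<Omega>) (\<lambda>y. (k (y, z))\<^sup>2)" if "z \<in> ?P" for z
    using kernel_section_L2[OF \<Omega> assms(7-9)] that sub by auto
  have kop: "kernel_op k \<gamma> h y = (\<Sum>z\<in>?P. G z * (k (y, z) * h z))" for h y
    unfolding kernel_op_def by (rule int_\<gamma>)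
  note flow = gradient_flow_wellposed[OF fin sub kop grad_P lip sect assms(15)]
  show ?thesis
  proof (intro conjI allI impI ballI)
    show "\<exists>!f. gradient_flow_solution \<Omega> k \<gamma> L f0 f" by (rule flow(1))
    fix f and t :: real
    assume f: "gradient_flow_solution \<Omega> k \<gamma> L f0 f" and t: "0 \<le> t"
    show "(\<lambda>s. functional_gradient \<gamma> L (f s) x) integrable_on {0..t}" if "x \<in> ?P" for x
      by (rule flow(3)[OF _ _ _ f t that])
    fix x assume x: "x \<in> \<Omega>"
    have int: "((\<lambda>s. kernel_op k \<gamma> (functional_gradient \<gamma> L (f s)) x) has_integral f t x - f0 x) {0..t}"
      by (rule flow(2)[OF _ _ _ f t x])
    show "(\<lambda>s. kernel_op k \<gamma> (functional_gradient \<gamma> L (f s)) x) integrable_on {0..t}"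
      using int by (rule has_integral_integrable)
    show "f t x = f0 x + integral {0..t} (\<lambda>s. kernel_op k \<gamma> (functional_gradient \<gamma> L (f s)) x)"
      using int by (simp add: integral_unique)
    show "f t x = f0 x + kernel_op k \<gamma>
        (\<lambda>y\<in>?P. integral {0..t} (\<lambda>s. functional_gradient \<gamma> L (f s) y)) x"
      by (rule flow(4)[OF _ _ _ f t x])
  qed
qed

end
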